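(* All trees on $n$ vertices are maximal elements in the poset $\mathcal{S}_n$.
   Context: All graphs are finite and simple. The chromatic symmetric function of a graph $G$ with vertices $v_1,\dots,v_n$ is $X_G=\sum_{\kappa}x_{\kappa(v_1)}\cdots x_{\kappa(v_n)}$, summed over all proper colorings $\kappa:V(G)\to\{1,2,3,\dots\}$; it is a homogeneous symmetric function of degree $n$ over $\mathbb{Q}$. Let $s_\lambda$ be the Schur symmetric functions; $[s_\lambda]F$ denotes the coefficient of $s_\lambda$ in $F$ expanded in this basis, and $F$ is Schur-positive if $[s_\lambda]F\ge 0$ for all $\lambda$. For connected graphs $G,H$ on $n$ vertices (for which $[s_{(1^n)}]X_G$ and $[s_{(1^n)}]X_H$ are positive), set $$X_s(G,H)=X_G-\frac{[s_{(1^n)}]X_G}{[s_{(1^n)}]X_H}X_H.$$ $\mathcal{S}_n$ is the poset whose elements are the equivalence classes of connected graphs on $n$ vertices under $G\sim H\iff X_G=X_H$, ordered by $G\geq_s H$ if and only if $X_s(G,H)$ is Schur-positive. An element $x$ of a poset is maximal if $y\leq x$ for every $y$ comparable to $x$. *)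

theory Defs
  imports
    "Graph_Theory.Digraph_Component"
    "HOL-Library.Multiset"
    "HOL-Library.FuncSet"
    "HOL-Library.Function_Algebras"
begin

section \<open>Graphs\<close>

text \<open>
  A finite simple graph is a \<open>pair_graph\<close>: a finite, symmetric, loop-free digraph whose arcs are
  ordered pairs, every undirected edge being represented by its two orientations.
  The notion \<open>tree\<close> of \<open>Digraph_Component\<close> is unsuitable for such graphs, because it counts the
  closed walk along an edge and back as a cycle. A cycle of the undirected graph is a directed
  cycle of length at least 3.
\<close>

definition tree_graph :: "'v pair_pre_digraph \<Rightarrow> bool" where
  "tree_graph G \<longleftrightarrow> pair_graph G \<and> connected (with_proj G) \<and>
     \<not> (\<exists>p. pre_digraph.cycle (with_proj G) p \<and> 3 \<le> length p)"

definition connected_graphs :: "nat \<Rightarrow> 'v pair_pre_digraph set" where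
  "connected_graphs n = {G. pair_graph G \<and> connected (with_proj G) \<and> card (pverts G) = n}"


section \<open>Symmetric functions\<close>

text \<open>
  A formal power series over the rationals in the variables \<open>x\<^sub>1, x\<^sub>2, \<dots>\<close> is given by its
  coefficients; the multiset \<open>{#i\<^sub>1, \<dots>, i\<^sub>k#}\<close> stands for the monomial \<open>x\<^bsub>i\<^sub>1\<^esub> \<cdots> x\<^bsub>i\<^sub>k\<^esub>\<close>. Addition and
  subtraction are pointwise. The series defined below vanish on multisets containing \<open>0\<close>.
\<close>

type_synonym series = "nat multiset \<Rightarrow> rat"

definition scale_series :: "rat \<Rightarrow> series \<Rightarrow> series" where
  "scale_series c F = (\<lambda>M. c * F M)"

interpretation series: vector_space scale_series
  by unfold_locales (auto simp: scale_series_def fun_eq_iff algebra_simps)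

definition proper_colorings :: "'v pair_pre_digraph \<Rightarrow> ('v \<Rightarrow> nat) set" where
  "proper_colorings G = {\<kappa> \<in> pverts G \<rightarrow>\<^sub>E {1..}. \<forall>(u, v) \<in> parcs G. \<kappa> u \<noteq> \<kappa> v}"

definition chromatic_sf :: "'v pair_pre_digraph \<Rightarrow> series" where
  "chromatic_sf G = (\<lambda>M. of_nat (card
     {\<kappa> \<in> proper_colorings G. image_mset \<kappa> (mset_set (pverts G)) = M}))"

definition int_partition :: "nat list \<Rightarrow> bool" where
  "int_partition la \<longleftrightarrow> sorted_wrt (\<ge>) la \<and> 0 \<notin> set la"

definition cells :: "nat list \<Rightarrow> (nat \<times> nat) set" where
  "cells la = {(i, j). i < length la \<and> j < la ! i}"

text \<open>Semistandard Young tableaux, in English notation: the first index is the row.\<close>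

definition ssyt :: "nat list \<Rightarrow> (nat \<times> nat \<Rightarrow> nat) set" where
  "ssyt la = {t \<in> cells la \<rightarrow>\<^sub>E {1..}.
     (\<forall>i j. (i, j) \<in> cells la \<and> (i, Suc j) \<in> cells la \<longrightarrow> t (i, j) \<le> t (i, Suc j)) \<and>
     (\<forall>i j. (i, j) \<in> cells la \<and> (Suc i, j) \<in> cells la \<longrightarrow> t (i, j) < t (Suc i, j))}"

definition schur :: "nat list \<Rightarrow> series" where
  "schur la = (\<lambda>M. of_nat (card {t \<in> ssyt la. image_mset t (mset_set (cells la)) = M}))"

text \<open>
  The Schur functions are a basis of the space of symmetric functions, so they are linearly
  independent and distinct for distinct partitions; \<open>series.representation\<close> gives the coefficients
  in the expansion of an element of their span.
\<close>

definition schur_coeff :: "nat list \<Rightarrow> series \<Rightarrow> rat" where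
  "schur_coeff la F = series.representation (schur ` {mu. int_partition mu}) F (schur la)"

definition schur_positive :: "series \<Rightarrow> bool" where
  "schur_positive F \<longleftrightarrow> (\<forall>la. int_partition la \<longrightarrow> 0 \<le> schur_coeff la F)"


section \<open>The poset\<close>

text \<open>\<open>replicate n 1\<close> is the partition \<open>(1, \<dots>, 1)\<close> of \<open>n\<close>, the common number of vertices.\<close>

definition schur_diff :: "'v pair_pre_digraph \<Rightarrow> 'v pair_pre_digraph \<Rightarrow> series" where
  "schur_diff G H = (let n = card (pverts G) in
     chromatic_sf G - scale_series
       (schur_coeff (replicate n 1) (chromatic_sf G) / schur_coeff (replicate n 1) (chromatic_sf H))
       (chromatic_sf H))"

definition csf_equiv :: "nat \<Rightarrow> 'v pair_pre_digraph rel" where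
  "csf_equiv n = {(G, H). G \<in> connected_graphs n \<and> H \<in> connected_graphs n \<and>
     chromatic_sf G = chromatic_sf H}"

definition S_poset :: "nat \<Rightarrow> 'v pair_pre_digraph set set" where
  "S_poset n = connected_graphs n // csf_equiv n"

definition S_le :: "'v pair_pre_digraph set \<Rightarrow> 'v pair_pre_digraph set \<Rightarrow> bool" where
  "S_le B A \<longleftrightarrow> (\<exists>G \<in> A. \<exists>H \<in> B. schur_positive (schur_diff G H))"

lemma equiv_csf_equiv: "equiv (connected_graphs n) (csf_equiv n)"
  by (rule equivI) (auto simp: csf_equiv_def refl_on_def sym_def trans_def)

text \<open>The order does not depend on the chosen representatives.\<close>

lemma S_le_classes:
  assumes "G \<in> connected_graphs n" and "H \<in> connected_graphs n"
  shows "S_le (csf_equiv n `` {H}) (csf_equiv n `` {G}) \<longleftrightarrow> schur_positive (schur_diff G H)"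
proof -
  have "schur_diff G' H' = schur_diff G H"
    if "(G, G') \<in> csf_equiv n" "(H, H') \<in> csf_equiv n" for G' H'
    using that by (auto simp: csf_equiv_def connected_graphs_def schur_diff_def)
  moreover have "(G, G) \<in> csf_equiv n" "(H, H) \<in> csf_equiv n"
    using assms by (auto simp: csf_equiv_def)
  ultimately show ?thesis
    unfolding S_le_def by (metis Image_singleton_iff)
qed

definition maximal_element :: "'a set \<Rightarrow> ('a \<Rightarrow> 'a \<Rightarrow> bool) \<Rightarrow> 'a \<Rightarrow> bool" where
  "maximal_element P le x \<longleftrightarrow> x \<in> P \<and> (\<forall>y \<in> P. le x y \<or> le y x \<longrightarrow> le y x)"

end

theory Submission
  imports Defs "HOL-Combinatorics.Transposition"
begin

text \<open>
  The coefficient of \<open>s\<^bsub>(1\<^sup>n)\<^esub>\<close> in a symmetric function \<open>F\<close> of degree \<open>n\<close> is the sum of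
  \<open>(-1)\<^bsup>n - l\<^esup> [x\<^sub>1\<^bsup>a\<^sub>1\<^esup> \<cdots> x\<^sub>l\<^bsup>a\<^sub>l\<^esup>] F\<close> over all compositions \<open>(a\<^sub>1, \<dots>, a\<^sub>l)\<close> of \<open>n\<close>
  (expand \<open>e\<^sub>n\<close> in complete homogeneous functions). For a chromatic symmetric function this sum is the
  number of acyclic orientations, which is \<open>2\<^bsup>n - 1\<^esup>\<close> for a tree and at least \<open>2\<^bsup>n - 1\<^esup>\<close> for every
  connected graph. So if \<open>X\<^sub>H - c X\<^sub>T\<close> is Schur-positive with \<open>T\<close> a tree, then \<open>c \<ge> 1\<close>. The
  coefficient of \<open>x\<^sub>1 \<cdots> x\<^sub>n\<close> is \<open>n!\<close> in every \<open>X\<^sub>G\<close> and positive in every Schur function of degree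
  \<open>n\<close>; as it equals \<open>n! (1 - c) \<le> 0\<close> in the difference, the difference vanishes. Hence \<open>X\<^sub>T\<close> is a
  multiple of \<open>X\<^sub>H\<close> and \<open>X\<^sub>s(T, H) = 0\<close>.
\<close>

section \<open>Fillings and their alternating counts\<close>

text \<open>\<open>schur_coeff\<close> reads off \<open>series.representation\<close>, which is
  \<open>0\<close> for a dependent set and for a series outside the span. Independence of the Schur
  functions is therefore handled by a case distinction: in the dependent case every series is
  \<open>schur_positive\<close>. Membership of \<open>chromatic_sf G\<close> in the span has to be
  established, and this is what the symmetry of Schur functions is for: subtracting leading terms
  controls only the dominant monomials, and symmetry extends the control to all others. The
  functional \<open>alt_sum n\<close> is the pairing with e_n, because taking the coefficient of x^a
  is the pairing with h_a. It is evaluated without a scalar product: on Schur and on chromatic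
  functions alike it becomes a signed count of fillings, and both counts obey one recursion, which
  removes the class of the largest value.\<close>

text \<open>
  Proper colorings and semistandard tableaux are both maps restricted by the relative order of the
  values at two points: \<open>A x y\<close> permits \<open>\<kappa> x < \<kappa> y\<close>, and \<open>B x y\<close> permits \<open>\<kappa> x = \<kappa> y\<close>.
\<close>

definition fillings :: "('a \<Rightarrow> 'a \<Rightarrow> bool) \<Rightarrow> ('a \<Rightarrow> 'a \<Rightarrow> bool) \<Rightarrow> 'a set \<Rightarrow> ('a \<Rightarrow> nat) set" where
  "fillings A B S = {\<kappa> \<in> S \<rightarrow>\<^sub>E {1..}.
     \<forall>x \<in> S. \<forall>y \<in> S. (\<kappa> x < \<kappa> y \<longrightarrow> A x y) \<and> (\<kappa> x = \<kappa> y \<longrightarrow> B x y)}"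

definition filling_series :: "('a \<Rightarrow> 'a \<Rightarrow> bool) \<Rightarrow> ('a \<Rightarrow> 'a \<Rightarrow> bool) \<Rightarrow> 'a set \<Rightarrow> series" where
  "filling_series A B S =
     (\<lambda>M. of_nat (card {\<kappa> \<in> fillings A B S. image_mset \<kappa> (mset_set S) = M}))"

text \<open>A packed filling amounts to an ordered set partition of \<open>S\<close>; its block
  sizes form the composition of the overview.\<close>

definition packed_fillings :: "('a \<Rightarrow> 'a \<Rightarrow> bool) \<Rightarrow> ('a \<Rightarrow> 'a \<Rightarrow> bool) \<Rightarrow> 'a set \<Rightarrow> ('a \<Rightarrow> nat) set" where
  "packed_fillings A B S = {\<kappa> \<in> fillings A B S. \<kappa> ` S = {1..card (\<kappa> ` S)}}"

text \<open>The exponent has the parity of n - l but avoids truncated subtraction.\<close>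

definition alt_count :: "('a \<Rightarrow> 'a \<Rightarrow> bool) \<Rightarrow> ('a \<Rightarrow> 'a \<Rightarrow> bool) \<Rightarrow> 'a set \<Rightarrow> rat" where
  "alt_count A B S = (\<Sum>\<kappa> \<in> packed_fillings A B S. (-1) ^ (card S + card (\<kappa> ` S)))"

text \<open>These encode the compositions of \<open>n\<close>: the i-th part is the multiplicity of
  i, and \<open>card (set_mset M)\<close> is the number of parts.\<close>

definition packed_multisets :: "nat \<Rightarrow> nat multiset set" where
  "packed_multisets n = {M. size M = n \<and> set_mset M = {1..card (set_mset M)}}"

definition alt_sum :: "nat \<Rightarrow> series \<Rightarrow> rat" where
  "alt_sum n F = (\<Sum>M \<in> packed_multisets n. (-1) ^ (n + card (set_mset M)) * F M)"

lemma finite_multisets_size: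
  assumes "finite A"
  shows "finite {M. size M = n \<and> set_mset M \<subseteq> A}"
proof (rule finite_subset)
  show "{M. size M = n \<and> set_mset M \<subseteq> A} \<subseteq> mset ` {xs. set xs \<subseteq> A \<and> length xs = n}"
  proof
    fix M assume M: "M \<in> {M. size M = n \<and> set_mset M \<subseteq> A}"
    obtain xs where "mset xs = M" using ex_mset by blast
    then show "M \<in> mset ` {xs. set xs \<subseteq> A \<and> length xs = n}" using M by auto
  qed
qed (simp add: assms finite_lists_length_eq)

lemma card_set_mset_le: "card (set_mset M) \<le> size M"
proof -
  obtain xs where "mset xs = M" using ex_mset by blast
  then show ?thesis using card_length[of xs] by auto
qed

lemma finite_packed_multisets: "finite (packed_multisets n)"
proof (rule finite_subset)
  show "packed_multisets n \<subseteq> {M. size M = n \<and> set_mset M \<subseteq> {..n}}"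
  proof
    fix M assume M: "M \<in> packed_multisets n"
    then have "set_mset M = {1..card (set_mset M)}" "card (set_mset M) \<le> n"
      using card_set_mset_le[of M] by (auto simp: packed_multisets_def)
    then have "set_mset M \<subseteq> {..n}" by (metis atLeastAtMost_iff atMost_iff order_trans subsetI)
    then show "M \<in> {M. size M = n \<and> set_mset M \<subseteq> {..n}}" using M by (simp add: packed_multisets_def)
  qed
qed (simp add: finite_multisets_size)

lemma finite_packed_fillings:
  assumes "finite S" shows "finite (packed_fillings A B S)"
proof (rule finite_subset)
  show "packed_fillings A B S \<subseteq> S \<rightarrow>\<^sub>E {1..card S}"
  proof
    fix \<kappa> assume "\<kappa> \<in> packed_fillings A B S"
    then have "\<kappa> \<in> extensional S" "\<kappa> ` S = {1..card (\<kappa> ` S)}"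
      by (auto simp: packed_fillings_def fillings_def PiE_def)
    moreover have "card (\<kappa> ` S) \<le> card S" by (rule card_image_le[OF assms])
    ultimately have "\<kappa> ` S \<subseteq> {1..card S}" by (metis atLeastatMost_subset_iff order_refl)
    then show "\<kappa> \<in> S \<rightarrow>\<^sub>E {1..card S}" using \<open>\<kappa> \<in> extensional S\<close> by (auto simp: PiE_def)
  qed
qed (simp add: assms finite_PiE)

lemma alt_sum_filling_series:
  assumes "finite S"
  shows "alt_sum n (filling_series A B S) = (if card S = n then alt_count A B S else 0)"
proof (cases "card S = n")
  case True
  let ?g = "\<lambda>\<kappa>. image_mset \<kappa> (mset_set S)"
  have set_g: "set_mset (?g \<kappa>) = \<kappa> ` S" for \<kappa> :: "'a \<Rightarrow> nat" using assms by simp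
  have "alt_count A B S = (\<Sum>M \<in> packed_multisets n.
      \<Sum>\<kappa> \<in> {\<kappa> \<in> packed_fillings A B S. ?g \<kappa> = M}. (-1) ^ (card S + card (\<kappa> ` S)))"
    unfolding alt_count_def
    using True assms
    by (intro sum.group[symmetric] finite_packed_fillings finite_packed_multisets)
       (auto simp: packed_fillings_def packed_multisets_def)
  also have "\<dots> = (\<Sum>M \<in> packed_multisets n. (-1) ^ (n + card (set_mset M)) * filling_series A B S M)"
  proof (rule sum.cong[OF refl])
    fix M assume M: "M \<in> packed_multisets n"
    then have "{\<kappa> \<in> packed_fillings A B S. ?g \<kappa> = M} = {\<kappa> \<in> fillings A B S. ?g \<kappa> = M}"
      using set_g by (auto simp: packed_fillings_def packed_multisets_def)
    moreover have "(\<Sum>\<kappa> \<in> {\<kappa> \<in> packed_fillings A B S. ?g \<kappa> = M}. (-1) ^ (card S + card (\<kappa> ` S)))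
      = (\<Sum>\<kappa> \<in> {\<kappa> \<in> packed_fillings A B S. ?g \<kappa> = M}. ((-1) ^ (n + card (set_mset M)) :: rat))"
      using set_g True by (intro sum.cong) auto
    ultimately show "(\<Sum>\<kappa> \<in> {\<kappa> \<in> packed_fillings A B S. ?g \<kappa> = M}. (-1) ^ (card S + card (\<kappa> ` S)))
      = (-1) ^ (n + card (set_mset M)) * filling_series A B S M"
      by (simp add: filling_series_def)
  qed
  finally show ?thesis using True by (simp add: alt_sum_def)
next
  case False
  have "filling_series A B S M = 0" if "M \<in> packed_multisets n" for M
  proof -
    have "{\<kappa> \<in> fillings A B S. image_mset \<kappa> (mset_set S) = M} = {}"
      using that False by (auto simp: packed_multisets_def)
    then show ?thesis unfolding filling_series_def by (metis card.empty of_nat_0)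
  qed
  then show ?thesis using False by (simp add: alt_sum_def)
qed

text \<open>The conditions on \<open>K\<close> are all the constraints that involve the largest
  value: ties within \<open>K\<close>, and strict increase from the remaining points into
  \<open>K\<close>. What is left on \<open>S - K\<close> is an arbitrary packed filling.\<close>

definition top_classes :: "('a \<Rightarrow> 'a \<Rightarrow> bool) \<Rightarrow> ('a \<Rightarrow> 'a \<Rightarrow> bool) \<Rightarrow> 'a set \<Rightarrow> 'a set set" where
  "top_classes A B S = {K. K \<subseteq> S \<and> K \<noteq> {} \<and> (\<forall>x \<in> K. \<forall>y \<in> K. B x y) \<and> (\<forall>x \<in> S - K. \<forall>y \<in> K. A x y)}"

lemma alt_count_empty: "alt_count A B {} = 1"
proof -
  have "packed_fillings A B {} = {\<lambda>_. undefined}"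
    by (auto simp: packed_fillings_def fillings_def)
  then show ?thesis by (simp add: alt_count_def)
qed

text \<open>The set \<open>K\<close> is the class of points with the largest value.\<close>

lemma alt_count_rec:
  assumes S: "finite S" "S \<noteq> {}"
  shows "alt_count A B S = - (\<Sum>K \<in> top_classes A B S. (-1) ^ card K * alt_count A B (S - K))"
proof -
  let ?P = "packed_fillings A B" and ?top = "\<lambda>\<kappa>. {x \<in> S. \<kappa> x = card (\<kappa> ` S)}"
  have pos: "card (\<kappa> ` S) > 0" for \<kappa> :: "'a \<Rightarrow> nat" using S by (simp add: card_gt_0_iff)
  have le: "\<kappa> x \<le> card (\<kappa> ` S)" if "\<kappa> \<in> ?P S" "x \<in> S" for \<kappa> x
  proof -
    have "\<kappa> x \<in> \<kappa> ` S" using that by simp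
    moreover have "\<kappa> ` S = {1..card (\<kappa> ` S)}" using that by (simp add: packed_fillings_def)
    ultimately show ?thesis by (metis atLeastAtMost_iff)
  qed
  have top: "?top \<kappa> \<in> top_classes A B S" if k: "\<kappa> \<in> ?P S" for \<kappa>
  proof -
    have "card (\<kappa> ` S) \<in> {1..card (\<kappa> ` S)}" using pos[of \<kappa>] by simp
    moreover have "\<kappa> ` S = {1..card (\<kappa> ` S)}" using k by (simp add: packed_fillings_def)
    ultimately have "card (\<kappa> ` S) \<in> \<kappa> ` S" by metis
    then have "?top \<kappa> \<noteq> {}" by force
    moreover have "\<kappa> x < card (\<kappa> ` S)" if "x \<in> S" "x \<notin> ?top \<kappa>" for x
      using le[OF k, of x] that by auto
    ultimately show ?thesis
      using k by (auto simp: top_classes_def packed_fillings_def fillings_def)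
  qed
  have fin: "finite (top_classes A B S)"
    by (rule finite_subset[of _ "Pow S"]) (auto simp: top_classes_def S)
  \<comment> \<open>Deleting \<open>K\<close> removes \<open>card K\<close> points and exactly one
    value, which accounts for the factor \<open>(-1) ^ card K\<close> and the extra minus
    sign.\<close>
  have inner: "(\<Sum>\<kappa> \<in> {\<kappa> \<in> ?P S. ?top \<kappa> = K}. (-1) ^ (card S + card (\<kappa> ` S)))
      = - ((-1) ^ card K * alt_count A B (S - K))" if K: "K \<in> top_classes A B S" for K
  proof -
    \<comment> \<open>The inverse of the restriction to \<open>S - K\<close>: a packed filling of
      \<open>S - K\<close> has largest value \<open>card\<close> of its image, so the next number is
      the new top value.\<close>
    let ?ext = "\<lambda>\<kappa>. \<lambda>x \<in> S. if x \<in> K then Suc (card (\<kappa> ` (S - K))) else \<kappa> x"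
    have KS: "K \<subseteq> S" "K \<noteq> {}" using K by (auto simp: top_classes_def)
    have cK: "card S = card K + card (S - K)"
      using KS S by (metis card_Diff_subset card_mono finite_subset le_add_diff_inverse)
    have down_img: "\<kappa> ` (S - K) = {1..card (\<kappa> ` S) - 1}" "card (\<kappa> ` S) = Suc (card (\<kappa> ` (S - K)))"
      if k: "\<kappa> \<in> ?P S" "?top \<kappa> = K" for \<kappa>
    proof -
      have eq: "\<kappa> ` S = {1..card (\<kappa> ` S)}" using k by (simp add: packed_fillings_def)
      have "\<kappa> ` (S - K) = \<kappa> ` S - {card (\<kappa> ` S)}" using k(2) by auto
      also have "\<dots> = {1..card (\<kappa> ` S)} - {card (\<kappa> ` S)}" using eq by simp
      also have "\<dots> = {1..card (\<kappa> ` S) - 1}" by auto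
      finally show 1: "\<kappa> ` (S - K) = {1..card (\<kappa> ` S) - 1}" .
      show "card (\<kappa> ` S) = Suc (card (\<kappa> ` (S - K)))" unfolding 1 using pos[of \<kappa>] by simp
    qed
    have ext_img: "?ext \<kappa> ` S = {1..Suc (card (\<kappa> ` (S - K)))}" if "\<kappa> \<in> ?P (S - K)" for \<kappa>
    proof -
      have "\<kappa> ` (S - K) = {1..card (\<kappa> ` (S - K))}" using that by (simp add: packed_fillings_def)
      moreover have "?ext \<kappa> ` S = insert (Suc (card (\<kappa> ` (S - K)))) (\<kappa> ` (S - K))"
        using KS by (auto simp: image_iff)
      ultimately show ?thesis by (metis atLeastAtMostSuc_conv le_add1 plus_1_eq_Suc)
    qed
    have less: "\<kappa> x < Suc (card (\<kappa> ` (S - K)))" "1 \<le> \<kappa> x" if "\<kappa> \<in> ?P (S - K)" "x \<in> S - K" for \<kappa> x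
    proof -
      have "\<kappa> x \<in> \<kappa> ` (S - K)" using that by simp
      moreover have "\<kappa> ` (S - K) = {1..card (\<kappa> ` (S - K))}" using that by (simp add: packed_fillings_def)
      ultimately have "\<kappa> x \<in> {1..card (\<kappa> ` (S - K))}" by metis
      then show "\<kappa> x < Suc (card (\<kappa> ` (S - K)))" "1 \<le> \<kappa> x" by auto
    qed
    have "(\<Sum>\<kappa> \<in> {\<kappa> \<in> ?P S. ?top \<kappa> = K}. (-1) ^ (card S + card (\<kappa> ` S)))
      = (\<Sum>\<kappa> \<in> ?P (S - K). - ((-1) ^ card K * (-1) ^ (card (S - K) + card (\<kappa> ` (S - K)))) :: rat)"
    proof (rule sum.reindex_bij_witness[where i = ?ext and j = "\<lambda>\<kappa>. restrict \<kappa> (S - K)"])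
      fix \<kappa> assume "\<kappa> \<in> {\<kappa> \<in> ?P S. ?top \<kappa> = K}"
      then have k: "\<kappa> \<in> ?P S" "?top \<kappa> = K" by auto
      have img: "restrict \<kappa> (S - K) ` (S - K) = \<kappa> ` (S - K)" by simp
      have extn: "\<kappa> \<in> extensional S" using k by (auto simp: packed_fillings_def fillings_def PiE_def)
      have "\<kappa> x = Suc (card (\<kappa> ` (S - K)))" if "x \<in> K" for x
        using that k(2) down_img(2)[OF k] by auto
      then show "?ext (restrict \<kappa> (S - K)) = \<kappa>"
        unfolding img using extn by (auto simp: fun_eq_iff extensional_def)
      show "restrict \<kappa> (S - K) \<in> ?P (S - K)"
      proof -
        have "restrict \<kappa> (S - K) \<in> fillings A B (S - K)"
          using k(1) by (auto simp: packed_fillings_def fillings_def)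
        moreover have "\<kappa> ` (S - K) = {1..card (\<kappa> ` (S - K))}"
          using down_img[OF k] by (metis diff_Suc_1)
        ultimately show ?thesis unfolding packed_fillings_def mem_Collect_eq img by blast
      qed
      show "- ((-1) ^ card K * (-1) ^ (card (S - K) + card (restrict \<kappa> (S - K) ` (S - K))))
        = ((-1) ^ (card S + card (\<kappa> ` S)) :: rat)"
        unfolding img using down_img(2)[OF k] cK by (simp add: power_add)
    next
      fix \<kappa> assume k: "\<kappa> \<in> ?P (S - K)"
      have extn: "\<kappa> \<in> extensional (S - K)" using k by (auto simp: packed_fillings_def fillings_def PiE_def)
      show "restrict (?ext \<kappa>) (S - K) = \<kappa>"
        using extn by (auto simp: fun_eq_iff extensional_def)
      have "?top (?ext \<kappa>) = K"
        unfolding ext_img[OF k] using KS less[OF k] by force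
      moreover have "?ext \<kappa> \<in> ?P S"
        unfolding packed_fillings_def fillings_def mem_Collect_eq ext_img[OF k]
      proof (intro conjI ballI)
        show "?ext \<kappa> \<in> S \<rightarrow>\<^sub>E {1..}" using less[OF k] by auto
        show "{1..Suc (card (\<kappa> ` (S - K)))} = {1..card {1..Suc (card (\<kappa> ` (S - K)))}}" by simp
        fix x y assume xy: "x \<in> S" "y \<in> S"
        show "?ext \<kappa> x < ?ext \<kappa> y \<longrightarrow> A x y" "?ext \<kappa> x = ?ext \<kappa> y \<longrightarrow> B x y"
          using xy k K less(1)[OF k, of x] less(1)[OF k, of y]
          by (auto simp: packed_fillings_def fillings_def top_classes_def)
      qed
      ultimately show "?ext \<kappa> \<in> {\<kappa> \<in> ?P S. ?top \<kappa> = K}" by simp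
    qed
    then show ?thesis by (simp add: alt_count_def sum_distrib_left sum_negf)
  qed
  have "alt_count A B S = (\<Sum>K \<in> top_classes A B S.
      \<Sum>\<kappa> \<in> {\<kappa> \<in> ?P S. ?top \<kappa> = K}. (-1) ^ (card S + card (\<kappa> ` S)))"
    unfolding alt_count_def using top
    by (intro sum.group[symmetric] finite_packed_fillings fin S) auto
  also have "\<dots> = (\<Sum>K \<in> top_classes A B S. - ((-1) ^ card K * alt_count A B (S - K)))"
    using inner by (intro sum.cong) auto
  finally show ?thesis by (simp add: sum_negf)
qed

text \<open>Toggling \<open>p\<close> is an involution of \<open>Z\<close> that changes the
  cardinality by one, so the sum equals its own negative.\<close>

lemma alternating_sum_toggle:
  assumes fin: "\<And>K. K \<in> Z \<Longrightarrow> finite K"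
    and toggle: "\<And>K. K \<in> Z \<Longrightarrow> (if p \<in> K then K - {p} else insert p K) \<in> Z"
  shows "(\<Sum>K \<in> Z. (-1) ^ card K) = (0 :: rat)"
proof -
  let ?t = "\<lambda>K. if p \<in> K then K - {p} else insert p K"
  have "(\<Sum>K \<in> Z. (-1) ^ card K) = (\<Sum>K \<in> Z. - ((-1) ^ card K) :: rat)"
  proof (rule sum.reindex_bij_witness[where i = ?t and j = ?t])
    fix K assume K: "K \<in> Z"
    show "?t K \<in> Z" "?t K \<in> Z" using toggle K by auto
    show "?t (?t K) = K" "?t (?t K) = K" by auto
    have "finite K" using fin K .
    show "- ((-1) ^ card (?t K)) = ((-1) ^ card K :: rat)"
    proof (cases "p \<in> K")
      case True
      then have "card K = Suc (card (K - {p}))" using \<open>finite K\<close> card.remove by metis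
      then show ?thesis by (simp only: True if_True power_Suc mult_minus1)
    qed (simp add: \<open>finite K\<close>)
  qed
  then show ?thesis by (simp add: sum_negf)
qed

section \<open>Semistandard tableaux as fillings, and the alternating count of a Young
  diagram\<close>

text \<open>The tableau conditions in contrapositive form: a smaller entry cannot stand directly to
  the right of or directly below a larger one, and vertical neighbours cannot tie.\<close>

definition tab_lt :: "nat \<times> nat \<Rightarrow> nat \<times> nat \<Rightarrow> bool" where
  "tab_lt x y \<longleftrightarrow> x \<noteq> (fst y, Suc (snd y)) \<and> x \<noteq> (Suc (fst y), snd y)"

definition tab_eq :: "nat \<times> nat \<Rightarrow> nat \<times> nat \<Rightarrow> bool" where
  "tab_eq x y \<longleftrightarrow> x \<noteq> (Suc (fst y), snd y) \<and> y \<noteq> (Suc (fst x), snd x)"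

lemma ssyt_eq_fillings: "ssyt la = fillings tab_lt tab_eq (cells la)"
proof -
  have "(\<forall>i j. (i, j) \<in> S \<and> (i, Suc j) \<in> S \<longrightarrow> t (i, j) \<le> t (i, Suc j)) \<and>
     (\<forall>i j. (i, j) \<in> S \<and> (Suc i, j) \<in> S \<longrightarrow> t (i, j) < t (Suc i, j)) \<longleftrightarrow>
     (\<forall>x \<in> S. \<forall>y \<in> S. (t x < t y \<longrightarrow> tab_lt x y) \<and> (t x = t y \<longrightarrow> tab_eq x y))"
    (is "?L \<longleftrightarrow> ?R") for S and t :: "nat \<times> nat \<Rightarrow> nat"
  proof
    assume ?L then show ?R by (fastforce simp: tab_lt_def tab_eq_def)
  next
    assume R: ?R
    have "t (i, j) \<le> t (i, Suc j)" if "(i, j) \<in> S" "(i, Suc j) \<in> S" for i j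
      using bspec[OF bspec[OF R that(2)] that(1)] by (auto simp: tab_lt_def)
    moreover have "t (i, j) < t (Suc i, j)" if "(i, j) \<in> S" "(Suc i, j) \<in> S" for i j
      using bspec[OF bspec[OF R that(2)] that(1)] by (auto simp: tab_lt_def tab_eq_def)
    ultimately show ?L by blast
  qed
  then show ?thesis by (simp add: ssyt_def fillings_def)
qed

lemma schur_eq_filling_series: "schur la = filling_series tab_lt tab_eq (cells la)"
  by (simp add: schur_def filling_series_def ssyt_eq_fillings)

text \<open>The finite order ideals are the Young diagrams. Working with sets of cells instead of
  partitions lets the recursion remove a top class without rebuilding a list.\<close>

definition order_ideal :: "(nat \<times> nat) set \<Rightarrow> bool" where
  "order_ideal S \<longleftrightarrow> (\<forall>i j. ((i, Suc j) \<in> S \<longrightarrow> (i, j) \<in> S) \<and> ((Suc i, j) \<in> S \<longrightarrow> (i, j) \<in> S))"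

lemma order_ideal_mono:
  assumes "order_ideal S" "(i, j) \<in> S" "i' \<le> i" "j' \<le> j"
  shows "(i', j') \<in> S"
proof -
  have down: "(i, j) \<in> S" if "(Suc i, j) \<in> S \<or> (i, Suc j) \<in> S" for i j
    using assms(1) that unfolding order_ideal_def by blast
  have "(i', j) \<in> S" using assms(3,2)
  proof (induction rule: inc_induct)
    case (step n)
    then show ?case using down by blast
  qed
  with assms(4) show ?thesis
  proof (induction rule: inc_induct)
    case (step n)
    then show ?case using down by blast
  qed
qed

lemma finite_nat_initial:
  assumes "finite {i. P i}" and down: "\<And>i. P (Suc i) \<Longrightarrow> P i"
  shows "\<exists>m. \<forall>i. P i \<longleftrightarrow> i < (m :: nat)"
proof -
  obtain k where "\<not> P k" using assms(1) infinite_UNIV_nat by (metis ex_new_if_finite mem_Collect_eq)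
  define m where "m = (LEAST k. \<not> P k)"
  have "\<not> P m" unfolding m_def by (rule LeastI) (rule \<open>\<not> P k\<close>)
  have "\<not> P i" if "m \<le> i" for i
    using that \<open>\<not> P m\<close> by (induction rule: dec_induct) (use down in auto)
  moreover have "P i" if "i < m" for i using that not_less_Least unfolding m_def by blast
  ultimately show ?thesis by (meson not_le)
qed

text \<open>
  By induction, only those \<open>K\<close> contribute to the recursion that leave a column. Unless the ideal is
  itself a column, they cancel in pairs by toggling the lowest cell of the first column.
\<close>

lemma alt_count_order_ideal:
  assumes "finite S" "order_ideal S"
  shows "alt_count tab_lt tab_eq S = (if \<exists>k. S = {..<k} \<times> {0} then 1 else 0)"
  using assms
proof (induction S rule: finite_psubset_induct)
  case (psubset S)
  let ?top = "top_classes tab_lt tab_eq S" and ?col = "\<lambda>k :: nat. {..<k} \<times> {0 :: nat}"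
  show ?case
  proof (cases "S = {}")
    case True
    then have "S = ?col 0" by simp
    then show ?thesis using True by (metis alt_count_empty)
  next
    case False
    \<comment> \<open>A remaining cell directly right of or below a cell of \<open>K\<close> would
      carry a smaller entry than that cell, which \<open>tab_lt\<close> forbids.\<close>
    have ideal: "order_ideal (S - K)" if K: "K \<in> ?top" for K
    proof -
      have lt: "tab_lt x y" if "x \<in> S - K" "y \<in> K" for x y using K that by (simp add: top_classes_def)
      have "(i, j) \<notin> K" if "(i, Suc j) \<in> S - K" for i j
        using lt[OF that, of "(i, j)"] by (auto simp: tab_lt_def)
      moreover have "(i, j) \<notin> K" if "(Suc i, j) \<in> S - K" for i j
        using lt[OF that, of "(i, j)"] by (auto simp: tab_lt_def)
      ultimately show ?thesis using psubset.prems unfolding order_ideal_def by blast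
    qed
    have fin_top: "finite ?top"
      by (rule finite_subset[of _ "Pow S"]) (auto simp: top_classes_def psubset.hyps)
    define Z where "Z = {K \<in> ?top. \<exists>k. S - K = ?col k}"
    have "alt_count tab_lt tab_eq S = - (\<Sum>K \<in> ?top. (-1) ^ card K * (if \<exists>k. S - K = ?col k then 1 else 0))"
      unfolding alt_count_rec[OF psubset.hyps(1) False]
    proof (intro arg_cong[of _ _ uminus] sum.cong refl arg_cong2[of _ _ _ _ "(*)"])
      fix K assume K: "K \<in> ?top"
      then have "S - K \<subset> S" by (auto simp: top_classes_def)
      then show "alt_count tab_lt tab_eq (S - K) = (if \<exists>k. S - K = ?col k then 1 else 0)"
        using ideal[OF K] psubset.IH by blast
    qed
    also have "\<dots> = - (\<Sum>K \<in> Z. (-1) ^ card K)"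
      unfolding Z_def by (subst sum.inter_filter[OF fin_top]) (intro arg_cong[of _ _ uminus] sum.cong, auto)
    finally have eq: "alt_count tab_lt tab_eq S = - (\<Sum>K \<in> Z. (-1) ^ card K)" .
    have "finite {i. (i, 0) \<in> S}"
      using finite_vimageI[OF psubset.hyps(1), of "\<lambda>i. (i, 0)"] by (simp add: vimage_def inj_on_def)
    moreover have "(i, 0) \<in> S" if "(Suc i, 0) \<in> S" for i
      using that psubset.prems unfolding order_ideal_def by blast
    ultimately obtain m where m: "\<And>i. (i, 0) \<in> S \<longleftrightarrow> i < m"
      using finite_nat_initial[of "\<lambda>i. (i, 0) \<in> S"] by blast
    obtain a b where "(a, b) \<in> S" using False by auto
    then have "(0, 0) \<in> S" using order_ideal_mono[OF psubset.prems] by blast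
    then have "m > 0" using m by blast
    define p where "p = (m - 1, 0 :: nat)"
    have "p \<in> S" using \<open>m > 0\<close> by (simp add: p_def m)
    \<comment> \<open>Two vertically adjacent cells cannot tie, so \<open>K\<close> takes at most
      the lowest cell \<open>p\<close> from the first column, whose height is
      \<open>m\<close>.\<close>
    have k_cases: "k = m - 1 \<or> k = m" if K: "K \<in> ?top" and "S - K = ?col k" for K k
    proof -
      have "?col k \<subseteq> S" unfolding \<open>S - K = ?col k\<close>[symmetric] by blast
      then have "k \<le> m" using m[of m] by (meson SigmaI insertI1 lessThan_iff less_irrefl not_le subsetD)
      moreover have "\<not> Suc k < m"
      proof
        assume "Suc k < m"
        have "(k, 0) \<in> S" "(Suc k, 0) \<in> S" using \<open>Suc k < m\<close> by (simp_all add: m)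
        moreover have "(k, 0) \<notin> S - K" "(Suc k, 0) \<notin> S - K" unfolding \<open>S - K = ?col k\<close> by simp_all
        ultimately show False using K by (auto simp: top_classes_def tab_eq_def)
      qed
      ultimately show ?thesis by linarith
    qed
    show ?thesis
    proof (cases "\<exists>k. S = ?col k")
      case True
      then obtain k where Sk: "S = ?col k" by blast
      have "i < k \<longleftrightarrow> i < m" for i using m[of i] unfolding Sk by simp
      then have "k = m" by (meson less_irrefl nat_neq_iff)
      then have Sm: "S = ?col m" using Sk by simp
      have Sp: "S - {p} = ?col (m - 1)" unfolding Sm p_def using \<open>m > 0\<close> by auto
      \<comment> \<open>For a column, \<open>k = m\<close> would make \<open>K\<close> empty. The
        only term left has sign -1, which the minus in front turns into 1.\<close>
      have "Z = {{p}}"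
      proof (intro equalityI subsetI)
        fix K assume K: "K \<in> Z"
        then obtain k where k: "S - K = ?col k" "K \<in> ?top" unfolding Z_def by blast
        have KS: "K \<noteq> {}" "K \<subseteq> S" using k(2) by (simp_all add: top_classes_def)
        then have "S - K \<noteq> S" by blast
        then have "k \<noteq> m" using k(1) Sm by metis
        then have "k = m - 1" using k_cases k by blast
        then have "S - K = S - {p}" using k(1) Sp by simp
        then show "K \<in> {{p}}" using KS \<open>p \<in> S\<close> by blast
      next
        fix K assume "K \<in> {{p}}"
        then have "K = {p}" by simp
        have "tab_lt x p" if "x \<in> S - {p}" for x
          using that unfolding Sp by (auto simp: tab_lt_def p_def)
        then have "{p} \<in> ?top"
          using \<open>p \<in> S\<close> by (simp add: top_classes_def tab_eq_def p_def)
        then show "K \<in> Z" using Sp \<open>K = {p}\<close> by (auto simp: Z_def)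
      qed
      then show ?thesis using eq True by simp
    next
      case False
      have colm: "insert p (?col (m - 1)) = ?col m" "?col m - {p} = ?col (m - 1)"
        using \<open>m > 0\<close> by (auto simp: p_def)
      \<comment> \<open>Cells outside an initial piece of the first column may always exceed the
        cells in it. Hence toggling \<open>p\<close> never violates the condition on the cells below
        \<open>K\<close> in value.\<close>
      have lt: "tab_lt x y" if "x \<in> ?col k" "y \<in> S - ?col k" "k \<le> m" for x y k
        using that by (cases x; cases y) (auto simp: tab_lt_def m)
      have "(\<Sum>K \<in> Z. (-1) ^ card K) = (0 :: rat)"
      proof (rule alternating_sum_toggle[where p = p])
        fix K assume "K \<in> Z"
        then obtain k where k: "S - K = ?col k" and K: "K \<in> ?top" unfolding Z_def by blast
        have KS: "K \<subseteq> S" using K by (simp add: top_classes_def)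
        show "finite K" using KS psubset.hyps finite_subset by blast
        show "(if p \<in> K then K - {p} else insert p K) \<in> Z"
        proof (cases "p \<in> K")
          case pK: True
          then have "p \<notin> ?col k" unfolding k[symmetric] by blast
          then have "k = m - 1" using k_cases[OF K k] \<open>m > 0\<close> by (auto simp: p_def)
          have "S - (K - {p}) = insert p (S - K)" using \<open>p \<in> S\<close> by blast
          then have eq: "S - (K - {p}) = ?col m" unfolding k \<open>k = m - 1\<close> colm .
          \<comment> \<open>Here it matters that \<open>S\<close> is not a column: otherwise
            removing \<open>p\<close> could empty \<open>K\<close>.\<close>
          then have "K - {p} \<noteq> {}" using False by (metis Diff_empty)
          moreover have "tab_lt x y" if "x \<in> S - (K - {p})" and "y \<in> K - {p}" for x y
            using that KS by (intro lt[of _ m]) (unfold eq[symmetric], auto)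
          ultimately have "K - {p} \<in> ?top" using K unfolding top_classes_def by blast
          then show ?thesis using pK eq unfolding Z_def by auto
        next
          case pK: False
          then have "p \<in> ?col k" unfolding k[symmetric] using \<open>p \<in> S\<close> by blast
          then have "k = m" using k_cases[OF K k] by (auto simp: p_def)
          have "S - insert p K = S - K - {p}" by blast
          then have eq: "S - insert p K = ?col (m - 1)" unfolding k \<open>k = m\<close> colm .
          have "tab_lt x y" if "x \<in> S - insert p K" and "y \<in> insert p K" for x y
            using that KS \<open>p \<in> S\<close> by (intro lt[of _ "m - 1"]) (unfold eq[symmetric], auto)
          \<comment> \<open>The cell above \<open>p\<close> stays in the column
            \<open>?col (m - 1)\<close> and there is no cell of \<open>S\<close> below
            \<open>p\<close>, so \<open>p\<close> may tie with all of \<open>K\<close>.\<close>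
          moreover have "tab_eq p y \<and> tab_eq y p" if "y \<in> insert p K" for y
          proof -
            have "y \<in> S - ?col (m - 1)" unfolding eq[symmetric] using that KS \<open>p \<in> S\<close> by blast
            then show ?thesis using \<open>m > 0\<close> by (cases y) (auto simp: tab_eq_def p_def m intro!: gr0I)
          qed
          ultimately have "insert p K \<in> ?top" using K \<open>p \<in> S\<close> unfolding top_classes_def by blast
          then show ?thesis using pK eq unfolding Z_def by auto
        qed
      qed
      then show ?thesis using eq False by simp
    qed
  qed
qed

lemma int_partition_nth_mono:
  assumes "int_partition la" "i \<le> j" "j < length la"
  shows "la ! j \<le> la ! i"
  using assms by (cases "i = j") (auto simp: int_partition_def sorted_wrt_iff_nth_less)

lemma finite_cells: "finite (cells la)"
proof -
  have "cells la = (SIGMA i:{..<length la}. {..<la ! i})" by (auto simp: cells_def)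
  then show ?thesis by simp
qed

lemma order_ideal_cells:
  assumes "int_partition la"
  shows "order_ideal (cells la)"
proof -
  have "(i, j) \<in> cells la" if "(Suc i, j) \<in> cells la" for i j
    using that int_partition_nth_mono[OF assms, of i "Suc i"] by (simp add: cells_def)
  moreover have "(i, j) \<in> cells la" if "(i, Suc j) \<in> cells la" for i j
    using that by (simp add: cells_def)
  ultimately show ?thesis unfolding order_ideal_def by blast
qed

lemma cells_eq_column_iff:
  assumes "int_partition la"
  shows "cells la = {..<k} \<times> {0} \<longleftrightarrow> la = replicate k 1"
proof
  assume eq: "cells la = {..<k} \<times> {0}"
  have one: "la ! i = 1" if "i < length la" for i
  proof -
    have "la ! i \<noteq> 0" using assms that by (metis int_partition_def nth_mem)
    moreover have "(i, 1) \<notin> cells la" using eq by auto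
    then have "la ! i \<le> 1" using that by (auto simp: cells_def)
    ultimately show ?thesis by simp
  qed
  then have "cells la = {..<length la} \<times> {0}" by (auto simp: cells_def)
  then have "card ({..<k} \<times> {0 :: nat}) = card ({..<length la} \<times> {0 :: nat})" using eq by simp
  then have "length la = k" by (simp add: card_cartesian_product)
  then show "la = replicate k 1" using one by (simp add: list_eq_iff_nth_eq)
qed (auto simp: cells_def)

text \<open>On Schur functions \<open>alt_sum n\<close> is the coordinate functional of the column:
  only columns have a nonzero alternating count, and the degree fixes the height.\<close>

lemma alt_sum_schur:
  assumes "int_partition la"
  shows "alt_sum n (schur la) = (if la = replicate n 1 then 1 else 0)"
proof -
  have "card (cells (replicate n 1)) = n"
    using cells_eq_column_iff[of "replicate n 1" n] by (simp add: int_partition_def sorted_wrt_iff_nth_less)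
  moreover have "la = replicate n 1" if "card (cells la) = n" "la = replicate k 1" for k
  proof -
    have "cells la = {..<k} \<times> {0}" using that cells_eq_column_iff assms by blast
    then show ?thesis using that by simp
  qed
  ultimately have "card (cells la) = n \<and> (\<exists>k. la = replicate k 1) \<longleftrightarrow> la = replicate n 1"
    by metis
  moreover have "alt_sum n (schur la) =
      (if card (cells la) = n then if \<exists>k. la = replicate k 1 then 1 else 0 else 0)"
    using assms
    by (simp add: schur_eq_filling_series alt_sum_filling_series[OF finite_cells]
      alt_count_order_ideal[OF finite_cells order_ideal_cells] cells_eq_column_iff)
  ultimately show ?thesis by presburger
qed

section \<open>Acyclic orientations\<close>

definition acyclic_orientations :: "'a rel \<Rightarrow> 'a set \<Rightarrow> 'a rel set" where
  "acyclic_orientations E S = {r. r \<subseteq> E \<inter> S \<times> S \<and> acyclic r \<and>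
     (\<forall>(x, y) \<in> E \<inter> S \<times> S. (x, y) \<in> r \<longleftrightarrow> (y, x) \<notin> r)}"

lemma finite_acyclic_orientations: "finite S \<Longrightarrow> finite (acyclic_orientations E S)"
  by (rule finite_subset[of _ "Pow (S \<times> S)"]) (auto simp: acyclic_orientations_def)

text \<open>Every vertex of a cycle has an outgoing arc, whereas the heads of the arcs in
  \<open>s\<close> have none. So a cycle of the union would already lie in \<open>r\<close>.\<close>

lemma acyclic_Un_into_sinks:
  assumes "acyclic r" and sinks: "Range s \<inter> Domain (r \<union> s) = {}"
  shows "acyclic (r \<union> s)"
proof (rule acyclicI, rule allI, rule notI)
  have "(x, y) \<in> r\<^sup>+" if "(x, y) \<in> (r \<union> s)\<^sup>+" "y \<in> Domain (r \<union> s)" for x y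
    using that
  proof (induction rule: trancl_induct)
    case (base y)
    then show ?case using sinks by blast
  next
    case (step y z)
    then have "(y, z) \<in> r" "y \<in> Domain (r \<union> s)" using sinks by blast+
    then show ?case using step.IH by (meson trancl_into_trancl)
  qed
  then show False if "(x, x) \<in> (r \<union> s)\<^sup>+" for x
    using that \<open>acyclic r\<close> by (meson DomainI Domain.cases acyclic_def tranclD)
qed

lemma acyclic_Un_from_sources:
  assumes "acyclic r" and sources: "Domain s \<inter> Range (r \<union> s) = {}"
  shows "acyclic (r \<union> s)"
proof -
  have "acyclic (r\<inverse> \<union> s\<inverse>)"
    by (rule acyclic_Un_into_sinks) (use assms in auto)
  then show ?thesis by (simp add: acyclic_converse flip: converse_Un)
qed

definition sinks :: "'a rel \<Rightarrow> 'a set \<Rightarrow> 'a set" where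
  "sinks r S = {x \<in> S. \<forall>y. (x, y) \<notin> r}"

lemma sinks_nonempty:
  assumes "finite S" "S \<noteq> {}" "r \<in> acyclic_orientations E S"
  shows "sinks r S \<noteq> {}"
proof -
  have r: "r \<subseteq> S \<times> S" "acyclic r" using assms(3) by (auto simp: acyclic_orientations_def)
  then have "finite r" using assms(1) finite_subset by blast
  then have "wf (r\<inverse>)" using r finite_acyclic_wf_converse by blast
  then obtain z where "z \<in> S" "\<And>y. (y, z) \<in> r\<inverse> \<Longrightarrow> y \<notin> S"
    using assms(2) by (meson all_not_in_conv wfE_min)
  then show ?thesis using r by (auto simp: sinks_def)
qed

text \<open>If \<open>K\<close> consists of sinks, no edge lies inside \<open>K\<close> and every
  edge between \<open>K\<close> and its complement must point into \<open>K\<close>. The rest is any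
  acyclic orientation of \<open>S - K\<close>, since arcs into sinks close no cycle.\<close>

lemma card_acyclic_orientations_sinks:
  assumes "sym E" "K \<subseteq> S"
  shows "card {r \<in> acyclic_orientations E S. K \<subseteq> sinks r S} =
    (if E \<inter> K \<times> K = {} then card (acyclic_orientations E (S - K)) else 0)"
proof (cases "E \<inter> K \<times> K = {}")
  case False
  then obtain x y where xy: "(x, y) \<in> E" "x \<in> K" "y \<in> K" by auto
  have "\<not> K \<subseteq> sinks r S" if r: "r \<in> acyclic_orientations E S" for r
  proof -
    have "(x, y) \<in> E \<inter> S \<times> S" using xy assms(2) by blast
    then have "(x, y) \<in> r \<or> (y, x) \<in> r" using r unfolding acyclic_orientations_def by blast
    then show ?thesis using xy unfolding sinks_def by blast
  qed
  then have "{r \<in> acyclic_orientations E S. K \<subseteq> sinks r S} = {}" by blast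
  then show ?thesis using False by (simp only: card.empty if_False)
next
  case True
  \<comment> \<open>\<open>?N\<close> is the set of arcs whose direction is forced.\<close>
  let ?U = "S - K" and ?N = "E \<inter> (S - K) \<times> K"
  have "bij_betw (\<lambda>r. r \<union> ?N) (acyclic_orientations E ?U)
      {r \<in> acyclic_orientations E S. K \<subseteq> sinks r S}"
  proof (rule bij_betwI[where g = "\<lambda>r. r \<inter> ?U \<times> ?U"])
    show "(\<lambda>r. r \<union> ?N) \<in> acyclic_orientations E ?U \<rightarrow> {r \<in> acyclic_orientations E S. K \<subseteq> sinks r S}"
    proof
      fix r assume r: "r \<in> acyclic_orientations E ?U"
      then have rU: "r \<subseteq> E \<inter> ?U \<times> ?U" and orient: "\<And>x y. (x, y) \<in> E \<Longrightarrow> x \<in> ?U \<Longrightarrow> y \<in> ?U \<Longrightarrow> (x, y) \<in> r \<longleftrightarrow> (y, x) \<notin> r"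
        by (auto simp: acyclic_orientations_def)
      have "acyclic (r \<union> ?N)"
        using r rU by (intro acyclic_Un_into_sinks) (auto simp: acyclic_orientations_def)
      moreover have "(x, y) \<in> r \<union> ?N \<longleftrightarrow> (y, x) \<notin> r \<union> ?N" if "(x, y) \<in> E" "x \<in> S" "y \<in> S" for x y
      proof (cases "x \<in> K \<or> y \<in> K")
        case True
        then show ?thesis using that rU \<open>E \<inter> K \<times> K = {}\<close> \<open>sym E\<close> by (auto dest: symD)
      next
        case False
        then show ?thesis using that orient by auto
      qed
      ultimately show "r \<union> ?N \<in> {r \<in> acyclic_orientations E S. K \<subseteq> sinks r S}"
        using rU assms(2) by (auto simp: acyclic_orientations_def sinks_def)
    qed
    show "(\<lambda>r. r \<inter> ?U \<times> ?U) \<in> {r \<in> acyclic_orientations E S. K \<subseteq> sinks r S} \<rightarrow> acyclic_orientations E ?U"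
      by (auto simp: acyclic_orientations_def intro: acyclic_subset)
    show "(r \<union> ?N) \<inter> ?U \<times> ?U = r" if "r \<in> acyclic_orientations E ?U" for r
      using that by (auto simp: acyclic_orientations_def)
    show "r \<inter> ?U \<times> ?U \<union> ?N = r" if "r \<in> {r \<in> acyclic_orientations E S. K \<subseteq> sinks r S}" for r
    proof -
      have r: "r \<subseteq> E \<inter> S \<times> S" "\<And>x y. (x, y) \<in> E \<Longrightarrow> x \<in> S \<Longrightarrow> y \<in> S \<Longrightarrow> (x, y) \<in> r \<longleftrightarrow> (y, x) \<notin> r"
        "\<And>x y. x \<in> K \<Longrightarrow> (x, y) \<notin> r"
        using that by (auto simp: acyclic_orientations_def sinks_def)
      have "?N \<subseteq> r" using r assms(2) by blast
      moreover have "r \<subseteq> ?U \<times> ?U \<union> ?N" using r(1,3) by blast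
      ultimately show ?thesis by blast
    qed
  qed
  then show ?thesis using True by (simp add: bij_betw_same_card)
qed

text \<open>
  Both sides satisfy the same recursion: the independent sets \<open>K\<close> consisting of sinks of a fixed
  acyclic orientation are the subsets of its nonempty set of sinks, so their signs cancel.
\<close>

lemma alt_count_acyclic_orientations:
  assumes "finite S" "sym E" "irrefl E"
  shows "alt_count (\<lambda>_ _. True) (\<lambda>x y. (x, y) \<notin> E) S = of_nat (card (acyclic_orientations E S))"
  using assms(1)
proof (induction S rule: finite_psubset_induct)
  case (psubset S)
  let ?c = "\<lambda>S. of_nat (card (acyclic_orientations E S)) :: rat"
  let ?O = "acyclic_orientations E S" and ?top = "top_classes (\<lambda>_ _. True) (\<lambda>x y. (x, y) \<notin> E) S"
  show ?case
  proof (cases "S = {}")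
    case True
    then have "acyclic_orientations E S = {{}}" by (auto simp: acyclic_orientations_def acyclic_def)
    then show ?thesis using True by (simp add: alt_count_empty)
  next
    case False
    have fin_O: "finite ?O" using psubset.hyps by (rule finite_acyclic_orientations)
    have indep: "{K \<in> Pow S. E \<inter> K \<times> K = {}} = insert {} ?top"
      by (auto simp: top_classes_def)
    have fin_top: "finite ?top"
      by (rule finite_subset[of _ "Pow S"]) (auto simp: top_classes_def psubset.hyps)
    \<comment> \<open>Inclusion-exclusion over sets of sinks: each inner sum vanishes because there
      is a sink. Exchanging the two sums counts, for fixed \<open>K\<close>, the orientations that
      have \<open>K\<close> among their sinks.\<close>
    have "0 = (\<Sum>r \<in> ?O. \<Sum>K \<in> Pow (sinks r S). (-1) ^ card K :: rat)"
    proof (rule sum.neutral[symmetric], rule ballI)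
      fix r assume r: "r \<in> ?O"
      obtain p where "p \<in> sinks r S" using sinks_nonempty[OF psubset.hyps False r] by blast
      moreover have "finite (sinks r S)" using psubset.hyps by (simp add: sinks_def)
      ultimately show "(\<Sum>K \<in> Pow (sinks r S). (-1) ^ card K) = (0 :: rat)"
        by (intro alternating_sum_toggle[where p = p]) (auto intro: finite_subset)
    qed
    also have "\<dots> = (\<Sum>r \<in> ?O. \<Sum>K \<in> {K \<in> Pow S. K \<subseteq> sinks r S}. (-1) ^ card K)"
      by (intro sum.cong) (auto simp: sinks_def)
    also have "\<dots> = (\<Sum>K \<in> Pow S. \<Sum>r \<in> {r \<in> ?O. K \<subseteq> sinks r S}. (-1) ^ card K)"
      using psubset.hyps by (intro sum.swap_restrict fin_O) auto
    also have "\<dots> = (\<Sum>K \<in> Pow S. (-1) ^ card K * (if E \<inter> K \<times> K = {} then ?c (S - K) else 0))"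
      by (intro sum.cong refl)
        (simp add: card_acyclic_orientations_sinks[OF assms(2)] del: Int_iff)
    also have "\<dots> = (\<Sum>K \<in> {K \<in> Pow S. E \<inter> K \<times> K = {}}. (-1) ^ card K * ?c (S - K))"
      using psubset.hyps by (subst sum.inter_filter) (auto intro!: sum.cong)
    \<comment> \<open>The empty \<open>K\<close> yields the count for \<open>S\<close> itself, the
      nonempty ones the right-hand side of \<open>alt_count_rec\<close> up to sign.\<close>
    also have "\<dots> = ?c S + (\<Sum>K \<in> ?top. (-1) ^ card K * ?c (S - K))"
      unfolding indep using fin_top by (subst sum.insert) (auto simp: top_classes_def)
    also have "(\<Sum>K \<in> ?top. (-1) ^ card K * ?c (S - K)) =
        (\<Sum>K \<in> ?top. (-1) ^ card K * alt_count (\<lambda>_ _. True) (\<lambda>x y. (x, y) \<notin> E) (S - K))"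
    proof (intro sum.cong refl)
      fix K assume "K \<in> ?top"
      then have "S - K \<subset> S" by (auto simp: top_classes_def)
      then show "(-1) ^ card K * ?c (S - K) =
          (-1) ^ card K * alt_count (\<lambda>_ _. True) (\<lambda>x y. (x, y) \<notin> E) (S - K)"
        using psubset.IH by simp
    qed
    finally show ?thesis using alt_count_rec[OF psubset.hyps False] by simp
  qed
qed

text \<open>Every acyclic orientation of \<open>S\<close> extends with \<open>v\<close> as a source
  and with \<open>v\<close> as a sink, and the two extensions differ because \<open>v\<close> has a
  neighbour. With a single neighbour there is one edge to orient, so there are no further
  extensions.\<close>

lemma
  assumes "sym E" and irr: "irrefl E" and "finite S" "v \<notin> S" and N: "N = {x \<in> S. (v, x) \<in> E}" "N \<noteq> {}"
  shows card_acyclic_orientations_insert_ge: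
      "2 * card (acyclic_orientations E S) \<le> card (acyclic_orientations E (insert v S))"
    and card_acyclic_orientations_insert_le:
      "N = {x} \<Longrightarrow> card (acyclic_orientations E (insert v S)) \<le> 2 * card (acyclic_orientations E S)"
proof -
  let ?O = "acyclic_orientations E S" and ?O' = "acyclic_orientations E (insert v S)"
  let ?out = "\<lambda>r. r \<union> {v} \<times> N" and ?in = "\<lambda>r. r \<union> N \<times> {v}"
  have sub: "r \<subseteq> S \<times> S" if "r \<in> ?O" for r using that by (auto simp: acyclic_orientations_def)
  have fin: "finite ?O" using \<open>finite S\<close> by (rule finite_acyclic_orientations)
  have inj: "inj_on ?out ?O" "inj_on ?in ?O"
  proof -
    have "?out r \<inter> S \<times> S = r" "?in r \<inter> S \<times> S = r" if "r \<in> ?O" for r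
      using sub[OF that] \<open>v \<notin> S\<close> by auto
    then show "inj_on ?out ?O" "inj_on ?in ?O" by (metis (no_types, lifting) inj_onI)+
  qed
  show "2 * card ?O \<le> card ?O'"
  proof -
    have vN: "a \<in> N \<longleftrightarrow> (a, v) \<in> E" "a \<in> N \<longleftrightarrow> (v, a) \<in> E" if "a \<in> S" for a
      using that N(1) \<open>sym E\<close> by (auto dest: symD)
    have vv: "(v, v) \<notin> E" using irr by (simp add: irrefl_def)
    have mem: "?out r \<in> ?O'" "?in r \<in> ?O'" if r: "r \<in> ?O" for r
    proof -
      have acyc: "acyclic r" and rE: "r \<subseteq> E \<inter> S \<times> S"
        and orient: "\<And>a b. (a, b) \<in> E \<Longrightarrow> a \<in> S \<Longrightarrow> b \<in> S \<Longrightarrow> (a, b) \<in> r \<longleftrightarrow> (b, a) \<notin> r"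
        using r by (auto simp: acyclic_orientations_def)
      have NS: "N \<subseteq> S" using N by blast
      have "acyclic (?out r)"
        by (rule acyclic_Un_from_sources[OF acyc]) (use rE NS \<open>v \<notin> S\<close> in auto)
      moreover have "acyclic (?in r)"
        by (rule acyclic_Un_into_sinks[OF acyc]) (use rE NS \<open>v \<notin> S\<close> in auto)
      moreover have "?out r \<subseteq> E \<inter> insert v S \<times> insert v S" "?in r \<subseteq> E \<inter> insert v S \<times> insert v S"
        using rE NS vN by auto
      moreover have "((a, b) \<in> ?out r \<longleftrightarrow> (b, a) \<notin> ?out r) \<and> ((a, b) \<in> ?in r \<longleftrightarrow> (b, a) \<notin> ?in r)"
        if ab: "(a, b) \<in> E" "a \<in> insert v S" "b \<in> insert v S" for a b
      proof (cases "a = v \<or> b = v")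
        case True
        then have "a = v \<and> b \<in> N \<or> b = v \<and> a \<in> N" using ab vN vv by auto
        then show ?thesis using rE NS \<open>v \<notin> S\<close> by auto
      next
        case False
        then show ?thesis using ab orient[of a b] NS by auto
      qed
      ultimately show "?out r \<in> ?O'" "?in r \<in> ?O'"
        unfolding acyclic_orientations_def by blast+
    qed
    obtain y where "y \<in> N" using N by blast
    have "?out r \<noteq> ?in r'" if "r' \<in> ?O" for r r'
    proof -
      have "(v, y) \<in> ?out r" using \<open>y \<in> N\<close> by simp
      moreover have "(v, y) \<notin> ?in r'" using sub[OF that] N \<open>v \<notin> S\<close> by auto
      ultimately show ?thesis by metis
    qed
    then have "card (?out ` ?O \<union> ?in ` ?O) = card (?out ` ?O) + card (?in ` ?O)"
      using fin by (intro card_Un_disjoint) auto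
    moreover have "card (?out ` ?O \<union> ?in ` ?O) \<le> card ?O'"
      using mem by (intro card_mono finite_acyclic_orientations) (use \<open>finite S\<close> in auto)
    ultimately show ?thesis using inj by (simp add: card_image)
  qed
  show "card ?O' \<le> 2 * card ?O" if x: "N = {x}"
  proof -
    have "?O' \<subseteq> ?out ` ?O \<union> ?in ` ?O"
    proof
      fix r assume r: "r \<in> ?O'"
      have "r \<inter> S \<times> S \<in> ?O"
        using r by (auto simp: acyclic_orientations_def intro: acyclic_subset)
      moreover have "r = r \<inter> S \<times> S \<union> {v} \<times> N \<or> r = r \<inter> S \<times> S \<union> N \<times> {v}"
      proof -
        have E: "(v, x) \<in> E" "(x, v) \<in> E" "x \<in> S" using N x assms(1) by (auto dest: symD)
        then have "(v, x) \<in> r \<longleftrightarrow> (x, v) \<notin> r" using r by (auto simp: acyclic_orientations_def)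
        moreover have "r \<subseteq> S \<times> S \<union> {(v, x), (x, v)}"
        proof
          fix e assume "e \<in> r"
          then have "e \<in> E" "e \<in> insert v S \<times> insert v S" using r by (auto simp: acyclic_orientations_def)
          moreover have "y = x" if "y \<in> S" "(v, y) \<in> E \<or> (y, v) \<in> E" for y
            using that N x assms(1) by (blast dest: symD)
          moreover have "(v, v) \<notin> E" using irr by (simp add: irrefl_def)
          ultimately show "e \<in> S \<times> S \<union> {(v, x), (x, v)}" by (cases e) auto
        qed
        ultimately show ?thesis unfolding x by auto
      qed
      ultimately show "r \<in> ?out ` ?O \<union> ?in ` ?O" by blast
    qed
    then have "card ?O' \<le> card (?out ` ?O \<union> ?in ` ?O)" using fin by (intro card_mono) auto
    also have "\<dots> \<le> card (?out ` ?O) + card (?in ` ?O)" by (rule card_Un_le)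
    also have "\<dots> \<le> 2 * card ?O"
      using card_image_le[OF fin, of ?out] card_image_le[OF fin, of ?in] by linarith
    finally show ?thesis .
  qed
qed

section \<open>Growing a vertex set inside a connected graph\<close>

lemma pair_graph_sym: "pair_graph G \<Longrightarrow> sym (parcs G)"
  using pair_sym_digraph.pair_sym_arcs[of G]
  by (simp add: pair_graph_def pair_pseudo_graph_def symmetric_def)

lemma pair_graph_irrefl: "pair_graph G \<Longrightarrow> irrefl (parcs G)"
  using pair_loopfree_digraph.pair_no_loops[of G]
  by (force simp: pair_graph_def pair_digraph_def irrefl_def)

lemma connected_crossing_edge:
  assumes "pair_graph G" "connected (with_proj G)" "S \<subseteq> pverts G" "S \<noteq> {}" "S \<noteq> pverts G"
  obtains u v where "u \<in> S" "v \<in> pverts G - S" "(u, v) \<in> parcs G"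
proof -
  interpret pair_graph G by fact
  obtain a b where ab: "a \<in> S" "b \<in> pverts G" "b \<notin> S" using assms(3-5) by blast
  \<comment> \<open>\<open>connected\<close> refers to the symmetric closure. The arcs of
    \<open>G\<close> are already symmetric, so its paths are paths of \<open>G\<close>, and one from
    \<open>a\<close> to \<open>b\<close> has to leave \<open>S\<close>.\<close>
  have sc: "strongly_connected (with_proj (mk_symmetric (with_proj G)))"
    using assms(2) by (simp add: Digraph_Component.connected_def)
  have sub: "parcs (mk_symmetric (with_proj G)) \<subseteq> parcs G"
    using pair_graph_sym[OF assms(1)] by (auto simp: parcs_mk_symmetric dest: symD)
  have "a \<in> pverts G" using ab assms(3) by blast
  then have "a \<rightarrow>\<^sup>*\<^bsub>with_proj (mk_symmetric (with_proj G))\<^esub> b"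
    using sc ab by (auto simp: strongly_connected_def)
  then have "(a, b) \<in> (parcs (mk_symmetric (with_proj G)))\<^sup>*"
    by (auto dest: reachable_rtranclI)
  then have "(a, b) \<in> (parcs G)\<^sup>*" using sub rtrancl_mono by blast
  then have "b \<in> S \<or> (\<exists>u \<in> S. \<exists>v. v \<notin> S \<and> (u, v) \<in> parcs G)"
    by (induction rule: rtrancl_induct) (use ab in auto)
  then show ?thesis using ab that in_arcsD2 by blast
qed

text \<open>Connectivity of the subgraph induced by \<open>S\<close>, phrased with paths of
  \<open>G\<close> itself because such a path is later closed to a cycle of
  \<open>G\<close>.\<close>

definition paths_within :: "'v pair_pre_digraph \<Rightarrow> 'v set \<Rightarrow> bool" where
  "paths_within G S \<longleftrightarrow> (\<forall>x \<in> S. \<forall>y \<in> S. \<exists>p. pre_digraph.apath (with_proj G) x p y \<and>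
     set (pre_digraph.awalk_verts (with_proj G) x p) \<subseteq> S)"

lemma paths_within_insert:
  assumes "pair_graph G" "paths_within G S" "u \<in> S" "v \<in> pverts G - S" "(u, v) \<in> parcs G"
  shows "paths_within G (insert v S)"
proof -
  interpret pair_graph G by fact
  have vu: "(v, u) \<in> parcs G" using assms(5) pair_graph_sym[OF assms(1)] by (auto dest: symD)
  have path: "\<exists>p. apath x p y \<and> set (awalk_verts x p) \<subseteq> S" if "x \<in> S" "y \<in> S" for x y
    using assms(2) that unfolding paths_within_def awalk_verts_with_proj_eq by blast
  show ?thesis
    unfolding paths_within_def awalk_verts_with_proj_eq
  proof (intro ballI)
    fix x y assume xy: "x \<in> insert v S" "y \<in> insert v S"
    consider "x \<in> S" "y \<in> S" | "x = v" "y = v" | "x = v" "y \<in> S" | "x \<in> S" "y = v" using xy by blast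
    then show "\<exists>p. apath x p y \<and> set (awalk_verts x p) \<subseteq> insert v S"
    proof cases
      case 1
      then show ?thesis using path by blast
    next
      case 2
      then show ?thesis using assms(4) by (intro exI[of _ "[]"]) (simp add: apath_Nil_iff)
    next
      case 3
      then obtain p where p: "apath u p y" "set (awalk_verts u p) \<subseteq> S" using path assms(3) by blast
      then have "apath v ((v, u) # p) y" using vu assms(4) by (auto simp: apath_Cons_iff)
      then show ?thesis using 3 p by (intro exI[of _ "(v, u) # p"]) auto
    next
      case 4
      then obtain p where p: "apath x p u" "set (awalk_verts x p) \<subseteq> S" using path assms(3) by blast
      then have "awlast x p = u" by (auto simp: apath_def)
      then have last: "last (pawalk_verts x p) = u" by simp
      have uv: "apath u [(u, v)] v"
        using assms(3-5) in_arcsD1 by (auto simp: apath_simps)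
      have path_v: "apath x (p @ [(u, v)]) v"
        using p uv last assms(4) by (auto simp: apath_append_iff)
      then have "awalk_verts x (p @ [(u, v)]) = awalk_verts x p @ [v]"
        using last by (subst awalk_verts_append[of _ _ _ v]) (auto simp: apath_def)
      then show ?thesis using path_v 4 p by (intro exI[of _ "p @ [(u, v)]"]) auto
    qed
  qed
qed

text \<open>Two different neighbours of \<open>v\<close> in \<open>S\<close> are joined by a path
  inside \<open>S\<close>, which avoids \<open>v\<close>. Together with the two edges at
  \<open>v\<close> it forms a cycle, of length at least 3 since the path has an arc.\<close>

lemma tree_unique_neighbour:
  assumes "tree_graph G" "paths_within G S" "u \<in> S" "u' \<in> S" "v \<in> pverts G - S"
    and "(u, v) \<in> parcs G" "(u', v) \<in> parcs G"
  shows "u' = u"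
proof (rule ccontr)
  assume "u' \<noteq> u"
  interpret pair_graph G using assms(1) by (simp add: tree_graph_def)
  have vu: "(v, u) \<in> parcs G" using assms(6) pair_graph_sym[OF pair_graph] by (auto dest: symD)
  obtain p where p: "apath u p u'" "set (awalk_verts u p) \<subseteq> S"
    using assms(2-4) unfolding paths_within_def awalk_verts_with_proj_eq by blast
  then have w: "awalk u p u'" "distinct (awalk_verts u p)" by (auto simp: apath_def)
  have "p \<noteq> []" using \<open>u' \<noteq> u\<close> w(1) by (auto simp: awalk_Nil_iff)
  let ?q = "(v, u) # p @ [(u', v)]"
  have walk: "awalk u (p @ [(u', v)]) v"
    using w assms(5,7) by (auto simp: awalk_simps intro!: awalk_appendI)
  have "awalk_verts u (p @ [(u', v)]) = awalk_verts u p @ [v]"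
    using walk w by (subst awalk_verts_append) auto
  moreover have "awalk v ?q v" using walk vu w(1) by (simp add: awalk_Cons_iff)
  ultimately have "cycle ?q"
    using w p assms(5) by (auto simp: cycle_def intro!: exI[of _ v])
  moreover have "3 \<le> length ?q" using \<open>p \<noteq> []\<close> by (cases p) auto
  ultimately show False using assms(1) by (auto simp: tree_graph_def)
qed

text \<open>Vertices are added one at a time along edges leaving the current set. Each addition at
  least doubles the number of acyclic orientations, and in a tree exactly doubles it, because the
  new vertex has one neighbour in the set; \<open>paths_within\<close> is carried along to prove
  that. The first vertex has no edge, hence exponent \<open>k\<close> for \<open>Suc k\<close>
  vertices.\<close>

lemma connected_acyclic_orientations_grow:
  assumes "pair_graph G" "connected (with_proj G)" "Suc k \<le> card (pverts G)"
  shows "\<exists>S \<subseteq> pverts G. card S = Suc k \<and> 2 ^ k \<le> card (acyclic_orientations (parcs G) S) \<and>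
    (tree_graph G \<longrightarrow> paths_within G S \<and> card (acyclic_orientations (parcs G) S) \<le> 2 ^ k)"
  using assms(3)
proof (induction k)
  case 0
  interpret pair_graph G by fact
  obtain r where r: "r \<in> pverts G" using 0 by (metis Suc_le_eq card.empty equals0I less_irrefl)
  have "acyclic_orientations (parcs G) {r} = {{}}"
    using pair_graph_irrefl[OF assms(1)]
    by (auto simp: acyclic_orientations_def irrefl_def acyclic_def)
  moreover have "paths_within G {r}"
    using r by (auto simp: paths_within_def apath_Nil_iff intro!: exI[of _ "[]"])
  ultimately show ?case using r by (intro exI[of _ "{r}"]) simp
next
  case (Suc k)
  interpret pair_graph G by fact
  obtain S where S: "S \<subseteq> pverts G" "card S = Suc k"
    and ge: "2 ^ k \<le> card (acyclic_orientations (parcs G) S)"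
    and le: "tree_graph G \<Longrightarrow> paths_within G S \<and> card (acyclic_orientations (parcs G) S) \<le> 2 ^ k"
    using Suc by auto
  have "S \<noteq> {}" "S \<noteq> pverts G" "finite S" using S Suc.prems card.infinite by fastforce+
  then obtain u v where uv: "u \<in> S" "v \<in> pverts G - S" "(u, v) \<in> parcs G"
    using connected_crossing_edge[OF assms(1,2) S(1)] by blast
  define N where "N = {x \<in> S. (v, x) \<in> parcs G}"
  have sym: "sym (parcs G)" and irrefl: "irrefl (parcs G)"
    by (simp_all add: pair_graph_sym pair_graph_irrefl assms(1))
  have "u \<in> N" using uv sym by (auto simp: N_def dest: symD)
  then have "N \<noteq> {}" by blast
  have v: "v \<notin> S" using uv by blast
  note insert = sym irrefl \<open>finite S\<close> v N_def \<open>N \<noteq> {}\<close>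
  have "2 ^ Suc k \<le> card (acyclic_orientations (parcs G) (insert v S))"
    using card_acyclic_orientations_insert_ge[OF insert] ge by simp
  moreover have "paths_within G (insert v S) \<and>
      card (acyclic_orientations (parcs G) (insert v S)) \<le> 2 ^ Suc k" if tree: "tree_graph G"
  proof
    show "paths_within G (insert v S)"
      using paths_within_insert[OF assms(1) _ uv] le[OF tree] by blast
    have "x = u" if "x \<in> N" for x
      using tree_unique_neighbour[OF tree _ uv(1) _ uv(2,3), of x] le[OF tree] that sym
      by (auto simp: N_def dest: symD)
    then have "N = {u}" using \<open>u \<in> N\<close> by blast
    then show "card (acyclic_orientations (parcs G) (insert v S)) \<le> 2 ^ Suc k"
      using card_acyclic_orientations_insert_le[OF insert] le[OF tree] by fastforce
  qed
  ultimately show ?case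
    using S uv v \<open>finite S\<close> by (intro exI[of _ "insert v S"]) auto
qed

lemma card_acyclic_orientations_connected:
  assumes "pair_graph G" "connected (with_proj G)"
  shows "2 ^ (card (pverts G) - 1) \<le> card (acyclic_orientations (parcs G) (pverts G))"
    and "tree_graph G \<Longrightarrow>
      card (acyclic_orientations (parcs G) (pverts G)) = 2 ^ (card (pverts G) - 1)"
proof -
  interpret pair_graph G by fact
  have "pverts G \<noteq> {}"
    using assms(2) by (auto simp: Digraph_Component.connected_def strongly_connected_def)
  then have "Suc (card (pverts G) - 1) = card (pverts G)"
    using pair_finite_verts by (simp add: card_gt_0_iff)
  moreover have "S = pverts G" if "S \<subseteq> pverts G" "card S = card (pverts G)" for S
    using that pair_finite_verts card_subset_eq by blast
  ultimately show "2 ^ (card (pverts G) - 1) \<le> card (acyclic_orientations (parcs G) (pverts G))"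
    "tree_graph G \<Longrightarrow> card (acyclic_orientations (parcs G) (pverts G)) = 2 ^ (card (pverts G) - 1)"
    using connected_acyclic_orientations_grow[OF assms, of "card (pverts G) - 1"]
    by (metis order_refl order_antisym)+
qed

section \<open>Chromatic symmetric functions as filling series\<close>

lemma proper_colorings_eq_fillings:
  assumes "pair_graph G"
  shows "proper_colorings G = fillings (\<lambda>_ _. True) (\<lambda>x y. (x, y) \<notin> parcs G) (pverts G)"
proof -
  interpret pair_graph G by fact
  show ?thesis by (auto simp: proper_colorings_def fillings_def dest: in_arcsD1 in_arcsD2)
qed

lemma chromatic_sf_eq_filling_series:
  assumes "pair_graph G"
  shows "chromatic_sf G = filling_series (\<lambda>_ _. True) (\<lambda>x y. (x, y) \<notin> parcs G) (pverts G)"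
  by (simp add: chromatic_sf_def filling_series_def proper_colorings_eq_fillings[OF assms])

lemma alt_sum_chromatic_sf:
  assumes "pair_graph G"
  shows "alt_sum (card (pverts G)) (chromatic_sf G) =
    of_nat (card (acyclic_orientations (parcs G) (pverts G)))"
proof -
  interpret pair_graph G by fact
  have "sym (parcs G)" "irrefl (parcs G)"
    by (simp_all add: pair_graph_sym pair_graph_irrefl assms(1))
  then show ?thesis
    using pair_finite_verts
    by (simp add: chromatic_sf_eq_filling_series[OF assms] alt_sum_filling_series alt_count_acyclic_orientations)
qed

section \<open>Symmetry of Schur functions\<close>

definition row_length :: "nat list \<Rightarrow> nat \<Rightarrow> nat" where
  "row_length la i = (if i < length la then la ! i else 0)"

lemma mem_cells_iff: "(i, j) \<in> cells la \<longleftrightarrow> j < row_length la i"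
  by (auto simp: cells_def row_length_def)

text \<open>
  Gelfand-Tsetlin patterns: \<open>g k i\<close> is the number of entries \<open>\<le> k\<close> in row \<open>i\<close> of a tableau.
\<close>

definition gt_patterns :: "nat list \<Rightarrow> (nat \<Rightarrow> nat \<Rightarrow> nat) set" where
  "gt_patterns la = {g. (\<forall>i. g 0 i = 0) \<and> (\<forall>k i. g k i \<le> g (Suc k) i) \<and>
     (\<forall>k i. g (Suc k) (Suc i) \<le> g k i) \<and> (\<exists>K. \<forall>k \<ge> K. \<forall>i. g k i = row_length la i)}"

definition thresholds :: "nat list \<Rightarrow> (nat \<times> nat \<Rightarrow> nat) \<Rightarrow> nat \<Rightarrow> nat \<Rightarrow> nat" where
  "thresholds la t k i = card {j. (i, j) \<in> cells la \<and> t (i, j) \<le> k}"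

text \<open>The inverse of \<open>thresholds\<close>: a cell enters the growing shape at the level
  equal to its entry.\<close>

definition tableau_of :: "nat list \<Rightarrow> (nat \<Rightarrow> nat \<Rightarrow> nat) \<Rightarrow> nat \<times> nat \<Rightarrow> nat" where
  "tableau_of la g = (\<lambda>(i, j) \<in> cells la. LEAST k. j < g k i)"

lemma ssyt_row: "t \<in> ssyt la \<Longrightarrow> (i, Suc j) \<in> cells la \<Longrightarrow> t (i, j) \<le> t (i, Suc j)"
  by (auto simp: ssyt_def mem_cells_iff)

lemma ssyt_column:
  "t \<in> ssyt la \<Longrightarrow> (i, j) \<in> cells la \<Longrightarrow> (Suc i, j) \<in> cells la \<Longrightarrow> t (i, j) < t (Suc i, j)"
  by (auto simp: ssyt_def)

lemma ssyt_pos: "t \<in> ssyt la \<Longrightarrow> c \<in> cells la \<Longrightarrow> 1 \<le> t c"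
  by (cases c) (auto simp: ssyt_def PiE_def Pi_def)

text \<open>Rows increase weakly, so the entries up to \<open>k\<close> fill an initial segment of
  the row, and its length determines it.\<close>

lemma less_thresholds_iff:
  assumes "t \<in> ssyt la"
  shows "j < thresholds la t k i \<longleftrightarrow> (i, j) \<in> cells la \<and> t (i, j) \<le> k"
proof -
  let ?P = "\<lambda>j. (i, j) \<in> cells la \<and> t (i, j) \<le> k"
  have "finite {j. ?P j}" by (rule finite_subset[of _ "{..<row_length la i}"]) (auto simp: mem_cells_iff)
  moreover have "?P j" if "?P (Suc j)" for j
    using that ssyt_row[OF assms, of i j] by (simp add: mem_cells_iff)
  ultimately obtain m where m: "\<And>j. ?P j \<longleftrightarrow> j < m" using finite_nat_initial[of ?P] by blast
  then have "{j. ?P j} = {..<m}" by blast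
  then have "thresholds la t k i = m" by (simp add: thresholds_def)
  then show ?thesis using m by simp
qed

lemma nat_le_via_less: "(\<And>j. j < a \<Longrightarrow> j < b) \<Longrightarrow> a \<le> (b :: nat)"
  by (meson less_irrefl not_le)

text \<open>Positivity of the entries gives the zero level, strictness of the columns gives
  interlacing, and beyond the largest entry all cells are counted.\<close>

lemma thresholds_in_gt_patterns:
  assumes "int_partition la" "t \<in> ssyt la"
  shows "thresholds la t \<in> gt_patterns la"
proof -
  note less = less_thresholds_iff[OF assms(2)]
  have "thresholds la t 0 i = 0" for i
    using less[of 0 0 i] ssyt_pos[OF assms(2), of "(i, 0)"] by (metis neq0_conv not_one_le_zero le_zero_eq)
  moreover have "thresholds la t k i \<le> thresholds la t (Suc k) i" for k i
    by (rule nat_le_via_less) (auto simp: less)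
  moreover have "thresholds la t (Suc k) (Suc i) \<le> thresholds la t k i" for k i
  proof (rule nat_le_via_less)
    fix j assume "j < thresholds la t (Suc k) (Suc i)"
    then have j: "(Suc i, j) \<in> cells la" "t (Suc i, j) \<le> Suc k" by (simp_all add: less)
    then have "(i, j) \<in> cells la" using order_ideal_cells[OF assms(1)] unfolding order_ideal_def by blast
    then show "j < thresholds la t k i" using j ssyt_column[OF assms(2), of i j] by (simp add: less)
  qed
  moreover have "\<exists>K. \<forall>k \<ge> K. \<forall>i. thresholds la t k i = row_length la i"
  proof (intro exI allI impI)
    fix k i assume k: "Max (t ` cells la) \<le> k"
    have "t c \<le> k" if "c \<in> cells la" for c
      using k finite_cells[of la] that by (meson Max_ge finite_imageI image_eqI order_trans)
    then have "{j. (i, j) \<in> cells la \<and> t (i, j) \<le> k} = {..<row_length la i}"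
      by (auto simp: mem_cells_iff)
    then show "thresholds la t k i = row_length la i" by (simp add: thresholds_def)
  qed
  ultimately show ?thesis by (simp add: gt_patterns_def)
qed

context
  fixes la g
  assumes g: "g \<in> gt_patterns la"
begin

lemma gt_zero: "g 0 i = 0"
  and gt_mono_Suc: "g k i \<le> g (Suc k) i"
  and gt_interlace: "g (Suc k) (Suc i) \<le> g k i"
  using g by (auto simp: gt_patterns_def)

lemma gt_mono: "k \<le> k' \<Longrightarrow> g k i \<le> g k' i"
  by (rule lift_Suc_mono_le[of "\<lambda>k. g k i"]) (auto simp: gt_mono_Suc)

lemma gt_eventually: "\<exists>K. \<forall>k \<ge> K. \<forall>i. g k i = row_length la i"
  using g by (simp add: gt_patterns_def)

lemma gt_le_row_length: "g k i \<le> row_length la i"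
  using gt_eventually gt_mono[of k _ i] by (metis nat_le_linear order_refl)

text \<open>The counterpart of \<open>less_thresholds_iff\<close>; the two equivalences make
  \<open>thresholds\<close> and \<open>tableau_of\<close> inverse to each other.\<close>

lemma tableau_of_le_iff:
  assumes "(i, j) \<in> cells la"
  shows "tableau_of la g (i, j) \<le> k \<longleftrightarrow> j < g k i"
proof -
  have eq: "tableau_of la g (i, j) = (LEAST k. j < g k i)" using assms by (simp add: tableau_of_def)
  obtain K where "g K i = row_length la i" using gt_eventually by blast
  then have "j < g K i" using assms by (simp add: mem_cells_iff)
  then have "j < g (LEAST k. j < g k i) i" by (rule LeastI)
  then show ?thesis unfolding eq using gt_mono Least_le[of "\<lambda>k. j < g k i" k] by (meson less_le_trans)
qed

lemma tableau_of_in_ssyt: "tableau_of la g \<in> ssyt la"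
proof -
  let ?t = "tableau_of la g"
  have "?t c \<in> {1..}" if "c \<in> cells la" for c
    using that tableau_of_le_iff[of "fst c" "snd c" 0] by (simp add: gt_zero)
  moreover have "?t \<in> extensional (cells la)" by (simp add: tableau_of_def)
  ultimately have "?t \<in> cells la \<rightarrow>\<^sub>E {1..}" unfolding PiE_def Pi_def by blast
  moreover have "?t (i, j) \<le> ?t (i, Suc j)" if "(i, j) \<in> cells la" "(i, Suc j) \<in> cells la" for i j
    using that tableau_of_le_iff[of i "Suc j" "?t (i, Suc j)"] by (simp add: tableau_of_le_iff)
  moreover have "?t (i, j) < ?t (Suc i, j)" if c: "(i, j) \<in> cells la" "(Suc i, j) \<in> cells la" for i j
  proof -
    have lt: "j < g (?t (Suc i, j)) (Suc i)" using tableau_of_le_iff[OF c(2), of "?t (Suc i, j)"] by simp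
    \<comment> \<open>Level 0 is zero, so the lower entry is positive; one level earlier interlacing
      already puts column \<open>j\<close> into row \<open>i\<close>.\<close>
    then obtain k where k: "?t (Suc i, j) = Suc k" by (metis gt_zero not_less_zero old.nat.exhaust)
    then have "j < g k i" using lt gt_interlace less_le_trans by metis
    then show ?thesis using tableau_of_le_iff[OF c(1), of k] k by simp
  qed
  ultimately show ?thesis by (auto simp: ssyt_def)
qed

lemma thresholds_tableau_of: "thresholds la (tableau_of la g) = g"
proof (intro ext)
  fix k i
  have "j < thresholds la (tableau_of la g) k i \<longleftrightarrow> j < g k i" for j
    using less_thresholds_iff[OF tableau_of_in_ssyt, of j k i] tableau_of_le_iff[of i j k]
      gt_le_row_length[of k i] by (auto simp: mem_cells_iff)
  then show "thresholds la (tableau_of la g) k i = g k i" by (meson nat_neq_iff less_irrefl)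
qed

end

lemma tableau_of_thresholds:
  assumes "int_partition la" "t \<in> ssyt la"
  shows "tableau_of la (thresholds la t) = t"
proof
  fix c
  show "tableau_of la (thresholds la t) c = t c"
  proof (cases "c \<in> cells la")
    case True
    obtain i j where c: "c = (i, j)" by fastforce
    have "tableau_of la (thresholds la t) c \<le> k \<longleftrightarrow> t c \<le> k" for k
      using tableau_of_le_iff[OF thresholds_in_gt_patterns[OF assms], of i j k]
        less_thresholds_iff[OF assms(2), of j k i] True c by simp
    then show ?thesis by (meson order_antisym order_refl)
  next
    case False
    then show ?thesis using assms(2) by (cases c) (auto simp: ssyt_def tableau_of_def PiE_def extensional_def)
  qed
qed

lemma bij_betw_thresholds:
  assumes "int_partition la"
  shows "bij_betw (thresholds la) (ssyt la) (gt_patterns la)"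
  using assms
  by (intro bij_betwI[where g = "tableau_of la"])
    (auto simp: thresholds_in_gt_patterns tableau_of_in_ssyt tableau_of_thresholds thresholds_tableau_of)

section \<open>Contents described by partial sums\<close>

text \<open>Partial sums suit patterns: level \<open>k\<close> records the entries up to
  \<open>k\<close>, and swapping two adjacent values alters a single partial sum.\<close>

definition cumulative :: "nat multiset \<Rightarrow> nat \<Rightarrow> nat" where
  "cumulative M k = size (filter_mset (\<lambda>x. x \<le> k) M)"

lemma cumulative_0: "cumulative M 0 = count M 0"
proof -
  have "filter_mset (\<lambda>x. x \<le> 0) M = replicate_mset (count M 0) 0"
    by (rule multiset_eqI) auto
  then show ?thesis by (simp add: cumulative_def)
qed

lemma cumulative_Suc: "cumulative M (Suc k) = cumulative M k + count M (Suc k)"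
proof -
  have "filter_mset (\<lambda>x. x \<le> Suc k) M = filter_mset (\<lambda>x. x \<le> k) M + replicate_mset (count M (Suc k)) (Suc k)"
    by (rule multiset_eqI) (auto simp: le_Suc_eq)
  then show ?thesis by (simp add: cumulative_def)
qed

lemma cumulative_inject:
  assumes "\<And>k. cumulative M k = cumulative N k"
  shows "M = N"
proof (rule multiset_eqI)
  fix k show "count M k = count N k"
    using assms[of k] assms[of "k - 1"] by (cases k) (auto simp: cumulative_0 cumulative_Suc)
qed

lemma count_image_transpose:
  "count (image_mset (Transposition.transpose a b) M) x = count M (Transposition.transpose a b x)"
proof -
  have "Transposition.transpose a b -` {x} = {Transposition.transpose a b x}"
    by (auto simp: transpose_eq_iff)
  then show ?thesis by (auto simp: count_image_mset not_in_iff Int_insert_left)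
qed

text \<open>The multiplicities of \<open>Suc k\<close> and \<open>Suc (Suc k)\<close> trade places.
  The resulting formula is the reflection that \<open>bender_knuth\<close> performs on the total
  size of a level.\<close>

lemma cumulative_transpose:
  fixes k :: nat
  defines "\<tau> \<equiv> Transposition.transpose (Suc k) (Suc (Suc k))"
  shows "j \<noteq> Suc k \<Longrightarrow> cumulative (image_mset \<tau> M) j = cumulative M j"
    and "cumulative (image_mset \<tau> M) (Suc k) =
      cumulative M k + cumulative M (Suc (Suc k)) - cumulative M (Suc k)"
proof -
  have low: "cumulative (image_mset \<tau> M) j = cumulative M j" if "j \<le> k" for j
    using that
    by (induction j) (simp_all add: cumulative_0 cumulative_Suc count_image_transpose \<tau>_def transpose_def)
  have mid: "cumulative (image_mset \<tau> M) (Suc k) = cumulative M k + count M (Suc (Suc k))"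
    using low[of k] by (simp add: cumulative_Suc count_image_transpose \<tau>_def)
  then show "cumulative (image_mset \<tau> M) (Suc k) =
      cumulative M k + cumulative M (Suc (Suc k)) - cumulative M (Suc k)"
    by (simp add: cumulative_Suc)
  have high: "cumulative (image_mset \<tau> M) (Suc (Suc k) + d) = cumulative M (Suc (Suc k) + d)" for d
  proof (induction d)
    case 0
    have "cumulative (image_mset \<tau> M) (Suc (Suc k)) = cumulative M k + count M (Suc (Suc k)) + count M (Suc k)"
      using mid by (simp add: cumulative_Suc[of _ "Suc k"] count_image_transpose \<tau>_def)
    then show ?case by (simp add: cumulative_Suc)
  next
    case (Suc d)
    have "count (image_mset \<tau> M) (Suc (Suc (Suc k) + d)) = count M (Suc (Suc (Suc k) + d))"
      unfolding \<tau>_def count_image_transpose by (simp add: transpose_def)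
    then show ?case using Suc by (simp only: add_Suc_right cumulative_Suc)
  qed
  show "cumulative (image_mset \<tau> M) j = cumulative M j" if "j \<noteq> Suc k"
  proof (cases "j \<le> k")
    case False
    then have "j = Suc (Suc k) + (j - Suc (Suc k))" using that by simp
    then show ?thesis using high by metis
  qed (rule low)
qed

definition level_size :: "nat list \<Rightarrow> (nat \<Rightarrow> nat \<Rightarrow> nat) \<Rightarrow> nat \<Rightarrow> nat" where
  "level_size la g k = (\<Sum>i<length la. g k i)"

lemma cumulative_content:
  "cumulative (image_mset t (mset_set (cells la))) k = level_size la (thresholds la t) k"
proof -
  have "cumulative (image_mset t (mset_set (cells la))) k = card {c \<in> cells la. t c \<le> k}"
    by (simp add: cumulative_def filter_mset_image_mset filter_mset_mset_set finite_cells)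
  also have "{c \<in> cells la. t c \<le> k} = (SIGMA i:{..<length la}. {j. (i, j) \<in> cells la \<and> t (i, j) \<le> k})"
    by (auto simp: cells_def)
  also have "card \<dots> = level_size la (thresholds la t) k"
    unfolding level_size_def thresholds_def
    by (intro card_SigmaI) (auto intro: finite_subset[of _ "{..<la ! _}"] simp: cells_def)
  finally show ?thesis .
qed

lemma schur_eq_card_gt_patterns:
  assumes "int_partition la"
  shows "schur la M = of_nat (card {g \<in> gt_patterns la. \<forall>k. level_size la g k = cumulative M k})"
proof -
  have "image_mset t (mset_set (cells la)) = M \<longleftrightarrow> (\<forall>k. level_size la (thresholds la t) k = cumulative M k)" for t
    using cumulative_inject[of "image_mset t (mset_set (cells la))" M] by (auto simp: cumulative_content)
  then have "bij_betw (thresholds la) {t \<in> ssyt la. image_mset t (mset_set (cells la)) = M}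
      {g \<in> gt_patterns la. \<forall>k. level_size la g k = cumulative M k}"
    using bij_betw_thresholds[OF assms] by (auto simp: bij_betw_def inj_on_def)
  then show ?thesis by (simp add: schur_def bij_betw_same_card)
qed

section \<open>The Bender-Knuth involution\<close>

text \<open>
  With the levels \<open>k\<close> and \<open>k + 2\<close> fixed, the entries of level \<open>k + 1\<close> range independently over
  intervals. Reflecting each interval is the Bender-Knuth involution.
\<close>

definition gt_lower :: "(nat \<Rightarrow> nat \<Rightarrow> nat) \<Rightarrow> nat \<Rightarrow> nat \<Rightarrow> nat" where
  "gt_lower g k i = max (g k i) (g (Suc (Suc k)) (Suc i))"

text \<open>Row \<open>0\<close> has no row above it to interlace with, so only the next level
  bounds it.\<close>

definition gt_upper :: "(nat \<Rightarrow> nat \<Rightarrow> nat) \<Rightarrow> nat \<Rightarrow> nat \<Rightarrow> nat" where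
  "gt_upper g k i = (case i of 0 \<Rightarrow> g (Suc (Suc k)) 0 | Suc i' \<Rightarrow> min (g (Suc (Suc k)) i) (g k i'))"

definition bender_knuth :: "nat \<Rightarrow> (nat \<Rightarrow> nat \<Rightarrow> nat) \<Rightarrow> nat \<Rightarrow> nat \<Rightarrow> nat" where
  "bender_knuth k g = g(Suc k := \<lambda>i. gt_lower g k i + gt_upper g k i - g (Suc k) i)"

lemma gt_bounds:
  assumes "g \<in> gt_patterns la"
  shows "gt_lower g k i \<le> g (Suc k) i" "g (Suc k) i \<le> gt_upper g k i"
  using gt_mono_Suc[OF assms] gt_interlace[OF assms]
  by (auto simp: gt_lower_def gt_upper_def split: nat.split)

lemma bender_knuth_in_gt_patterns:
  assumes g: "g \<in> gt_patterns la"
  shows "bender_knuth k g \<in> gt_patterns la"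
proof -
  let ?h = "bender_knuth k g"
  have other: "?h j = g j" if "j \<noteq> Suc k" for j using that by (simp add: bender_knuth_def)
  have mid: "gt_lower g k i \<le> ?h (Suc k) i" "?h (Suc k) i \<le> gt_upper g k i" for i
    using gt_bounds[OF g, of k i] by (simp_all add: bender_knuth_def)
  have low: "g k i \<le> ?h (Suc k) i" "g (Suc (Suc k)) (Suc i) \<le> ?h (Suc k) i" for i
    using mid(1)[of i] by (simp_all add: gt_lower_def)
  have up: "?h (Suc k) i \<le> g (Suc (Suc k)) i" "?h (Suc k) (Suc i) \<le> g k i" for i
    using mid(2)[of i] mid(2)[of "Suc i"] by (auto simp: gt_upper_def split: nat.splits)
  have "?h 0 i = 0" for i using other[of 0] gt_zero[OF g] by simp
  moreover have "?h j i \<le> ?h (Suc j) i \<and> ?h (Suc j) (Suc i) \<le> ?h j i" for j i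
  proof -
    consider "j = k" | "j = Suc k" | "j \<noteq> k" "j \<noteq> Suc k" by blast
    then show ?thesis
    proof cases
      case 1
      then show ?thesis using low up other[of k] by simp
    next
      case 2
      then show ?thesis using low up other[of "Suc (Suc k)"] by simp
    next
      case 3
      then show ?thesis using other[of j] other[of "Suc j"] gt_mono_Suc[OF g] gt_interlace[OF g] by simp
    qed
  qed
  moreover have "\<exists>K. \<forall>j \<ge> K. \<forall>i. ?h j i = row_length la i"
  proof -
    obtain K where K: "\<forall>j \<ge> K. \<forall>i. g j i = row_length la i" using gt_eventually[OF g] by blast
    show ?thesis by (rule exI[of _ "max K (Suc (Suc k))"]) (use K other in auto)
  qed
  ultimately show ?thesis by (simp add: gt_patterns_def)
qed

text \<open>The interval bounds depend only on levels \<open>k\<close> and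
  \<open>Suc (Suc k)\<close>, which the reflection leaves alone.\<close>

lemma bender_knuth_involution:
  assumes "g \<in> gt_patterns la"
  shows "bender_knuth k (bender_knuth k g) = g"
proof -
  have "gt_lower (bender_knuth k g) k = gt_lower g k" "gt_upper (bender_knuth k g) k = gt_upper g k"
    by (simp_all add: fun_eq_iff gt_lower_def gt_upper_def bender_knuth_def split: nat.split)
  then show ?thesis
    using gt_bounds[OF assms, of k]
    by (simp add: bender_knuth_def fun_eq_iff) (metis add_diff_cancel_left' diff_diff_cancel le_add2 trans_le_add1 trans_le_add2)
qed

lemma level_size_bender_knuth:
  assumes g: "g \<in> gt_patterns la"
  shows "level_size la (bender_knuth k g) (Suc k) =
      level_size la g k + level_size la g (Suc (Suc k)) - level_size la g (Suc k)"
    and "j \<noteq> Suc k \<Longrightarrow> level_size la (bender_knuth k g) j = level_size la g j"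
proof -
  show "j \<noteq> Suc k \<Longrightarrow> level_size la (bender_knuth k g) j = level_size la g j"
    by (simp add: level_size_def bender_knuth_def)
  \<comment> \<open>The upper bound of row \<open>Suc m\<close> and the lower bound of row
    \<open>m\<close> are the minimum and maximum of the same two numbers. This is why the two sums
    are offset by one row.\<close>
  have shifted: "(\<Sum>i<Suc m. gt_upper g k i) + (\<Sum>i<m. gt_lower g k i) =
      (\<Sum>i<Suc m. g (Suc (Suc k)) i) + (\<Sum>i<m. g k i)" for m
  proof (induction m)
    case (Suc m)
    have "gt_upper g k (Suc m) + gt_lower g k m = g (Suc (Suc k)) (Suc m) + g k m"
      by (simp add: gt_upper_def gt_lower_def min_def max_def)
    then show ?case using Suc by simp
  qed (simp add: gt_upper_def)
  have sum: "(\<Sum>i<length la. gt_lower g k i + gt_upper g k i) = level_size la g k + level_size la g (Suc (Suc k))"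
  proof (cases "length la")
    case (Suc m)
    \<comment> \<open>Row \<open>Suc m\<close> lies outside the shape, which settles the lower bound
      of the last row, left over by \<open>shifted\<close>.\<close>
    have "g (Suc (Suc k)) (Suc m) = 0"
      using gt_le_row_length[OF g, of "Suc (Suc k)" "Suc m"] Suc by (simp add: row_length_def)
    then have "gt_lower g k m = g k m" by (simp add: gt_lower_def)
    then show ?thesis using shifted[of m] Suc by (simp add: level_size_def sum.distrib)
  qed (simp add: level_size_def)
  have "level_size la (bender_knuth k g) (Suc k) =
      (\<Sum>i<length la. gt_lower g k i + gt_upper g k i) - (\<Sum>i<length la. g (Suc k) i)"
    unfolding level_size_def using gt_bounds[OF g, of k]
    by (simp add: bender_knuth_def sum_subtractf_nat trans_le_add2)
  then show "level_size la (bender_knuth k g) (Suc k) =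
      level_size la g k + level_size la g (Suc (Suc k)) - level_size la g (Suc k)"
    unfolding sum by (simp add: level_size_def)
qed

text \<open>Adjacent transpositions generate all finitary permutations of the positive indices;
  \<open>0\<close> is not the index of a variable.\<close>

definition symmetric_series :: "series \<Rightarrow> bool" where
  "symmetric_series F \<longleftrightarrow> (\<forall>M. 0 \<in># M \<longrightarrow> F M = 0) \<and>
     (\<forall>k M. F (image_mset (Transposition.transpose (Suc k) (Suc (Suc k))) M) = F M)"

lemma filling_series_zero:
  assumes "finite S" "0 \<in># M"
  shows "filling_series A B S M = 0"
proof -
  have "{\<kappa> \<in> fillings A B S. image_mset \<kappa> (mset_set S) = M} = {}"
    using assms by (fastforce simp: fillings_def)
  then show ?thesis unfolding filling_series_def by (metis card.empty of_nat_0)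
qed

lemma symmetric_schur:
  assumes "int_partition la"
  shows "symmetric_series (schur la)"
  unfolding symmetric_series_def
proof (intro conjI allI impI)
  show "schur la M = 0" if "0 \<in># M" for M
    using filling_series_zero[OF finite_cells that] by (simp add: schur_eq_filling_series)
  fix k M
  let ?\<tau> = "Transposition.transpose (Suc k) (Suc (Suc k))"
  let ?G = "\<lambda>M. {g \<in> gt_patterns la. \<forall>j. level_size la g j = cumulative M j}"
  have maps: "bender_knuth k g \<in> ?G (image_mset ?\<tau> M)" if "g \<in> ?G M" for g M
  proof -
    have "level_size la (bender_knuth k g) j = cumulative (image_mset ?\<tau> M) j" for j
      using that by (cases "j = Suc k") (simp_all add: level_size_bender_knuth cumulative_transpose)
    then show ?thesis using that bender_knuth_in_gt_patterns by blast
  qed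
  have twice: "image_mset ?\<tau> (image_mset ?\<tau> M) = M" by (simp add: multiset.map_comp)
  have "bij_betw (bender_knuth k) (?G M) (?G (image_mset ?\<tau> M))"
  proof (rule bij_betwI[where g = "bender_knuth k"])
    show "bender_knuth k \<in> ?G M \<rightarrow> ?G (image_mset ?\<tau> M)" using maps by blast
    show "bender_knuth k \<in> ?G (image_mset ?\<tau> M) \<rightarrow> ?G M" using maps[of _ "image_mset ?\<tau> M"] twice by auto
  qed (use bender_knuth_involution in blast)+
  then show "schur la (image_mset ?\<tau> M) = schur la M"
    by (simp only: schur_eq_card_gt_patterns[OF assms] bij_betw_same_card)
qed

text \<open>Only equalities between values are constrained here, and these survive every permutation
  of the values.\<close>

lemma symmetric_filling_series:
  assumes "finite S"
  shows "symmetric_series (filling_series (\<lambda>_ _. True) B S)"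
  unfolding symmetric_series_def
proof (intro conjI allI impI)
  show "filling_series (\<lambda>_ _. True) B S M = 0" if "0 \<in># M" for M
    using filling_series_zero[OF assms that] .
  fix k M
  let ?\<tau> = "Transposition.transpose (Suc k) (Suc (Suc k))"
  let ?F = "\<lambda>M. {\<kappa> \<in> fillings (\<lambda>_ _. True) B S. image_mset \<kappa> (mset_set S) = M}"
  let ?f = "\<lambda>\<kappa>. \<lambda>x \<in> S. ?\<tau> (\<kappa> x)"
  have pos: "Suc 0 \<le> ?\<tau> x" if "Suc 0 \<le> x" for x using that by (simp add: transpose_def)
  have maps: "?f \<kappa> \<in> ?F (image_mset ?\<tau> M)" if "\<kappa> \<in> ?F M" for \<kappa> M
  proof -
    have "image_mset (?f \<kappa>) (mset_set S) = image_mset (\<lambda>x. ?\<tau> (\<kappa> x)) (mset_set S)"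
      using assms by (intro image_mset_cong) simp
    also have "\<dots> = image_mset ?\<tau> M" using that by (auto simp: multiset.map_comp comp_def)
    finally have "image_mset (?f \<kappa>) (mset_set S) = image_mset ?\<tau> M" .
    moreover have "?f \<kappa> \<in> fillings (\<lambda>_ _. True) B S"
      using that pos by (auto simp: fillings_def PiE_def Pi_def dest: transpose_eq_imp_eq)
    ultimately show ?thesis by blast
  qed
  have twice: "image_mset ?\<tau> (image_mset ?\<tau> M) = M" by (simp add: multiset.map_comp)
  have inv: "?f (?f \<kappa>) = \<kappa>" if "\<kappa> \<in> fillings (\<lambda>_ _. True) B S" for \<kappa>
    using that by (auto simp: fillings_def fun_eq_iff PiE_def extensional_def)
  have "bij_betw ?f (?F M) (?F (image_mset ?\<tau> M))"
  proof (rule bij_betwI[where g = ?f])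
    show "?f \<in> ?F M \<rightarrow> ?F (image_mset ?\<tau> M)" using maps by blast
    show "?f \<in> ?F (image_mset ?\<tau> M) \<rightarrow> ?F M" using maps[of _ "image_mset ?\<tau> M"] twice by auto
  qed (use inv in blast)+
  then show "filling_series (\<lambda>_ _. True) B S (image_mset ?\<tau> M) = filling_series (\<lambda>_ _. True) B S M"
    by (simp only: filling_series_def bij_betw_same_card)
qed

section \<open>Expansion in Schur functions\<close>

lemma schur_nonzero_content:
  assumes "schur la M \<noteq> 0"
  obtains t where "t \<in> ssyt la" "image_mset t (mset_set (cells la)) = M"
proof -
  have "{t \<in> ssyt la. image_mset t (mset_set (cells la)) = M} \<noteq> {}"
    using assms unfolding schur_def by (metis card.empty of_nat_0)
  then show ?thesis using that by blast
qed

lemma schur_homogeneous: "schur la M \<noteq> 0 \<Longrightarrow> size M = card (cells la)"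
  by (erule schur_nonzero_content) auto

section \<open>Leading monomials of Schur functions\<close>

lemma ssyt_ge_row:
  assumes "int_partition la" "t \<in> ssyt la" "(i, j) \<in> cells la"
  shows "Suc i \<le> t (i, j)"
  using assms(3)
proof (induction i)
  case 0
  then show ?case using ssyt_pos[OF assms(2)] by fastforce
next
  case (Suc i)
  then have "(i, j) \<in> cells la" using order_ideal_cells[OF assms(1)] unfolding order_ideal_def by blast
  then show ?case using Suc ssyt_column[OF assms(2), of i j] by simp
qed

text \<open>The monomial x^la, which is the leading monomial of \<open>schur la\<close>.\<close>

definition superstandard_content :: "nat list \<Rightarrow> nat multiset" where
  "superstandard_content la = image_mset (\<lambda>(i, j). Suc i) (mset_set (cells la))"

lemma size_superstandard_content: "size (superstandard_content la) = card (cells la)"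
  by (simp add: superstandard_content_def)

text \<open>Entries are at least their row numbers (counted from 1), so the index sum is least
  exactly when all these inequalities are equalities.\<close>

lemma ssyt_content_sum:
  assumes "int_partition la" "t \<in> ssyt la"
  shows "sum_mset (superstandard_content la) \<le> sum_mset (image_mset t (mset_set (cells la)))"
    and "sum_mset (image_mset t (mset_set (cells la))) = sum_mset (superstandard_content la) \<Longrightarrow>
      c \<in> cells la \<Longrightarrow> t c = Suc (fst c)"
proof -
  have eq: "sum_mset (superstandard_content la) = (\<Sum>c \<in> cells la. Suc (fst c))"
    "sum_mset (image_mset t (mset_set (cells la))) = (\<Sum>c \<in> cells la. t c)"
    by (simp_all add: superstandard_content_def sum_unfold_sum_mset case_prod_unfold)
  have le: "Suc (fst c) \<le> t c" if "c \<in> cells la" for c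
    using ssyt_ge_row[OF assms, of "fst c" "snd c"] that by simp
  show "sum_mset (superstandard_content la) \<le> sum_mset (image_mset t (mset_set (cells la)))"
    unfolding eq by (rule sum_mono) (rule le)
  show "t c = Suc (fst c)"
    if "sum_mset (image_mset t (mset_set (cells la))) = sum_mset (superstandard_content la)" "c \<in> cells la"
    using sum_mono_inv[of "\<lambda>c. Suc (fst c)" "cells la" t c] le that finite_cells unfolding eq by simp
qed

lemma schur_triangular:
  assumes "int_partition la" "schur la M \<noteq> 0"
  shows "sum_mset (superstandard_content la) \<le> sum_mset M"
    and "sum_mset M = sum_mset (superstandard_content la) \<Longrightarrow> M = superstandard_content la"
proof -
  obtain t where t: "t \<in> ssyt la" "image_mset t (mset_set (cells la)) = M"
    using schur_nonzero_content[OF assms(2)] .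
  show "sum_mset (superstandard_content la) \<le> sum_mset M"
    using ssyt_content_sum(1)[OF assms(1) t(1)] unfolding t(2) .
  assume "sum_mset M = sum_mset (superstandard_content la)"
  then have "t c = Suc (fst c)" if "c \<in> cells la" for c
    using ssyt_content_sum(2)[OF assms(1) t(1)] that unfolding t(2) by blast
  then have "image_mset t (mset_set (cells la)) = superstandard_content la"
    unfolding superstandard_content_def by (intro image_mset_cong) (auto simp: finite_cells)
  then show "M = superstandard_content la" using t(2) by simp
qed

lemma schur_superstandard_content:
  assumes "int_partition la"
  shows "schur la (superstandard_content la) = 1"
proof -
  let ?t = "\<lambda>c \<in> cells la. Suc (fst c)"
  have "{t \<in> ssyt la. image_mset t (mset_set (cells la)) = superstandard_content la} = {?t}"
  proof (intro equalityI subsetI)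
    fix t assume "t \<in> {t \<in> ssyt la. image_mset t (mset_set (cells la)) = superstandard_content la}"
    then have t: "t \<in> ssyt la" "image_mset t (mset_set (cells la)) = superstandard_content la" by auto
    have "t c = Suc (fst c)" if "c \<in> cells la" for c
      using ssyt_content_sum(2)[OF assms t(1) _ that] t(2) by simp
    moreover have "t \<in> extensional (cells la)" using t(1) by (simp add: ssyt_def PiE_def)
    ultimately show "t \<in> {?t}" by (auto simp: fun_eq_iff extensional_def)
  next
    fix t assume "t \<in> {?t}"
    then have t: "t = ?t" by simp
    have "image_mset ?t (mset_set (cells la)) = superstandard_content la"
      unfolding superstandard_content_def by (intro image_mset_cong) (auto simp: finite_cells)
    moreover have "?t \<in> ssyt la" by (auto simp: ssyt_def)
    ultimately show "t \<in> {t \<in> ssyt la. image_mset t (mset_set (cells la)) = superstandard_content la}"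
      unfolding t by blast
  qed
  then show ?thesis by (simp add: schur_def)
qed

text \<open>The exponents of x_1, x_2, ... form a partition.\<close>

definition dominant :: "nat multiset \<Rightarrow> bool" where
  "dominant M \<longleftrightarrow> 0 \<notin># M \<and> (\<forall>k. count M (Suc (Suc k)) \<le> count M (Suc k))"

lemma count_superstandard_content:
  "count (superstandard_content la) 0 = 0"
  "count (superstandard_content la) (Suc i) = row_length la i"
proof -
  have count: "count (superstandard_content la) k = card {c \<in> cells la. Suc (fst c) = k}" for k
    unfolding superstandard_content_def
    by (simp add: count_conv_size_mset filter_mset_image_mset filter_mset_mset_set finite_cells case_prod_unfold)
  show "count (superstandard_content la) 0 = 0" by (simp add: count)
  have "{c \<in> cells la. Suc (fst c) = Suc i} = {i} \<times> {..<row_length la i}"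
    by (auto simp: mem_cells_iff)
  then show "count (superstandard_content la) (Suc i) = row_length la i"
    by (simp add: count card_cartesian_product)
qed

lemma dominant_obtain_partition:
  assumes "dominant M"
  obtains la where "int_partition la" "superstandard_content la = M"
proof -
  have down: "0 < count M (Suc k)" if "0 < count M (Suc (Suc k))" for k
    using assms that unfolding dominant_def by (meson less_le_trans)
  have "finite {k. 0 < count M (Suc k)}"
    using finite_vimageI[of "set_mset M" Suc] by (simp add: vimage_def)
  then obtain m where m: "\<And>k. 0 < count M (Suc k) \<longleftrightarrow> k < m"
    using finite_nat_initial[of "\<lambda>k. 0 < count M (Suc k)"] down by blast
  then have nz: "count M (Suc k) = 0 \<longleftrightarrow> \<not> k < m" for k by (metis neq0_conv)
  define la where "la = map (\<lambda>k. count M (Suc k)) [0..<m]"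
  have "count M (Suc j) \<le> count M (Suc i)" if "i \<le> j" for i j
    using that
  proof (induction j rule: dec_induct)
    case (step j)
    then show ?case using assms unfolding dominant_def by (meson order_trans)
  qed simp
  then have "int_partition la"
    using nz by (auto simp: int_partition_def la_def sorted_wrt_iff_nth_less)
  moreover have "superstandard_content la = M"
  proof (rule multiset_eqI)
    fix x show "count (superstandard_content la) x = count M x"
    proof (cases x)
      case 0
      then show ?thesis using assms by (simp add: count_superstandard_content dominant_def not_in_iff)
    next
      case (Suc k)
      then show ?thesis
        using nz[of k] by (simp add: count_superstandard_content row_length_def la_def)
    qed
  qed
  ultimately show ?thesis using that by blast
qed

text \<open>The larger exponent moves to the smaller index, so the index sum drops by the difference
  of the exponents.\<close>

lemma sum_mset_transpose_less:
  assumes "count M (Suc k) < count M (Suc (Suc k))"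
  shows "sum_mset (image_mset (Transposition.transpose (Suc k) (Suc (Suc k))) M) < sum_mset M"
proof -
  let ?\<tau> = "Transposition.transpose (Suc k) (Suc (Suc k))" and ?a = "count M (Suc k)" and ?b = "count M (Suc (Suc k))"
  define N where "N = filter_mset (\<lambda>x. x \<noteq> Suc k \<and> x \<noteq> Suc (Suc k)) M"
  have M: "M = N + replicate_mset ?a (Suc k) + replicate_mset ?b (Suc (Suc k))"
    by (rule multiset_eqI) (auto simp: N_def)
  have "image_mset ?\<tau> N = N"
    unfolding N_def by (rule trans[OF image_mset_cong[of _ _ id]]) (auto simp: transpose_def)
  then have "image_mset ?\<tau> M = N + replicate_mset ?a (Suc (Suc k)) + replicate_mset ?b (Suc k)"
    by (subst M) simp
  then have "sum_mset (image_mset ?\<tau> M) = sum_mset N + ?a * Suc (Suc k) + ?b * Suc k"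
    by (simp add: sum_mset_replicate_mset)
  moreover have "sum_mset M = sum_mset N + ?a * Suc k + ?b * Suc (Suc k)"
    by (subst (1) M) (simp add: sum_mset_replicate_mset)
  ultimately show ?thesis using assms by simp
qed

text \<open>Swapping two neighbouring exponents that are in the wrong order keeps the value of
  \<open>F\<close> and lowers the index sum, so the process stops, and it can stop only at a
  dominant multiset.\<close>

lemma symmetric_series_dominant:
  assumes "symmetric_series F" "F M \<noteq> 0"
  obtains N where "dominant N" "F N \<noteq> 0" "sum_mset N < sum_mset M \<or> N = M"
proof -
  have "\<exists>N. dominant N \<and> F N \<noteq> 0 \<and> (sum_mset N < sum_mset M \<or> N = M)"
    using assms(2)
  proof (induction "sum_mset M" arbitrary: M rule: less_induct)
    case less
    show ?case
    proof (cases "dominant M")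
      case False
      have "0 \<notin># M" using assms(1) less.prems unfolding symmetric_series_def by blast
      then obtain k where "count M (Suc k) < count M (Suc (Suc k))"
        using False unfolding dominant_def by (meson not_le)
      then have lt: "sum_mset (image_mset (Transposition.transpose (Suc k) (Suc (Suc k))) M) < sum_mset M"
        by (rule sum_mset_transpose_less)
      have "F (image_mset (Transposition.transpose (Suc k) (Suc (Suc k))) M) \<noteq> 0"
        using assms(1) less.prems unfolding symmetric_series_def by metis
      then show ?thesis using less.hyps[OF lt] lt by (metis less_trans)
    qed (use less.prems in blast)
  qed
  then show ?thesis using that by blast
qed

lemma symmetric_series_diff: "symmetric_series F \<Longrightarrow> symmetric_series G \<Longrightarrow> symmetric_series (F - G)"
  by (simp add: symmetric_series_def)

lemma symmetric_series_scale: "symmetric_series F \<Longrightarrow> symmetric_series (scale_series c F)"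
  by (simp add: symmetric_series_def scale_series_def)

lemma sum_series_apply: "(\<Sum>x \<in> X. f x :: series) M = (\<Sum>x \<in> X. f x M)"
  by (induction X rule: infinite_finite_induct) auto

lemma symmetric_series_sum:
  "(\<And>x. x \<in> X \<Longrightarrow> symmetric_series (f x)) \<Longrightarrow> symmetric_series (\<Sum>x \<in> X. f x)"
  by (simp add: symmetric_series_def sum_series_apply)

text \<open>The support of a dominant multiset has no gaps, so its largest index is at most the
  number of its elements.\<close>

lemma finite_dominant: "finite {M. dominant M \<and> size M = n}"
proof (rule finite_subset)
  show "{M. dominant M \<and> size M = n} \<subseteq> {M. size M = n \<and> set_mset M \<subseteq> {..n}}"
  proof
    fix M assume M: "M \<in> {M. dominant M \<and> size M = n}"
    have "x \<le> n" if x: "x \<in># M" for x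
    proof -
      have "y \<in># M" if "1 \<le> y" "y \<le> x" for y
        using that(2,1)
      proof (induction rule: inc_induct)
        case (step y)
        obtain k where k: "y = Suc k" using step.prems by (cases y) auto
        have "count M (Suc y) \<le> count M y" using M unfolding k dominant_def by blast
        then show ?case using step by (metis count_greater_zero_iff less_le_trans le_SucI)
      qed (rule x)
      then have "{1..x} \<subseteq> set_mset M" by auto
      then have "x \<le> card (set_mset M)" using card_mono[of "set_mset M" "{1..x}"] by simp
      also have "\<dots> \<le> n" using card_set_mset_le[of M] M by simp
      finally show ?thesis .
    qed
    then show "M \<in> {M. size M = n \<and> set_mset M \<subseteq> {..n}}" using M by auto
  qed
qed (simp add: finite_multisets_size)

text \<open>
  The Schur functions are unitriangular with respect to the monomials if these are ordered by the
  sum of their indices; the induction clears the dominant monomials in this order.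
\<close>

lemma symmetric_series_in_span_schur:
  assumes "symmetric_series F" "\<And>M. F M \<noteq> 0 \<Longrightarrow> size M = n"
  shows "F \<in> series.span (schur ` {mu. int_partition mu})"
proof -
  let ?D = "{M. dominant M \<and> size M = n}"
  \<comment> \<open>\<open>W\<close> exceeds the index sum of every dominant multiset of degree
    \<open>n\<close>. The induction parameter \<open>d\<close> bounds how far below \<open>W\<close>
    a nonzero coefficient can occur; at \<open>d = 0\<close> no dominant one remains, so the series
    vanishes.\<close>
  define W where "W = Suc (Max (insert 0 (sum_mset ` ?D)))"
  have W: "sum_mset M < W" if "M \<in> ?D" for M
    unfolding W_def using that finite_dominant[of n] by (simp add: less_Suc_eq_le)
  have "F \<in> series.span (schur ` {mu. int_partition mu})"
    if "symmetric_series F" "\<And>M. F M \<noteq> 0 \<Longrightarrow> size M = n" "\<And>M. F M \<noteq> 0 \<Longrightarrow> W \<le> sum_mset M + d" for F d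
    using that
  proof (induction d arbitrary: F)
    case 0
    have "F M = 0" for M
    proof (rule ccontr)
      assume "F M \<noteq> 0"
      then obtain N where N: "dominant N" "F N \<noteq> 0" using symmetric_series_dominant[OF 0(1)] by metis
      then show False using 0(2,3)[OF N(2)] W[of N] by simp
    qed
    then have "F = 0" by (simp add: fun_eq_iff)
    show ?case unfolding \<open>F = 0\<close> by (rule series.span_zero)
  next
    case (Suc d)
    \<comment> \<open>The dominant multisets with the smallest index sum that the bound still
      admits.\<close>
    define X where "X = {M \<in> ?D. sum_mset M + Suc d = W}"
    have finX: "finite X" by (rule finite_subset[OF _ finite_dominant[of n]]) (auto simp: X_def)
    have "\<exists>la. int_partition la \<and> superstandard_content la = M" if "M \<in> X" for M
      using that dominant_obtain_partition[of M] unfolding X_def by blast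
    then obtain shape where shape: "\<And>M. M \<in> X \<Longrightarrow> int_partition (shape M)"
      "\<And>M. M \<in> X \<Longrightarrow> superstandard_content (shape M) = M"
      by metis
    define G where "G = (\<Sum>M \<in> X. scale_series (F M) (schur (shape M)))"
    have G_span: "G \<in> series.span (schur ` {mu. int_partition mu})"
      unfolding G_def using shape(1)
      by (intro series.span_sum series.span_scale series.span_base) auto
    have tri: "N = M \<or> sum_mset N < sum_mset M" "size M = n" if "N \<in> X" "schur (shape N) M \<noteq> 0" for N M
    proof -
      show "N = M \<or> sum_mset N < sum_mset M"
        using schur_triangular[OF shape(1) that(2)] that(1) shape(2)[OF that(1)] by (metis le_neq_implies_less)
      show "size M = n"
        using schur_homogeneous[OF that(2)] size_superstandard_content[of "shape N"] shape(2)[OF that(1)] that(1)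
        by (simp add: X_def)
    qed
    have G_nonzero: "\<exists>N \<in> X. schur (shape N) M \<noteq> 0" if "G M \<noteq> 0" for M
    proof (rule ccontr)
      assume "\<not> (\<exists>N \<in> X. schur (shape N) M \<noteq> 0)"
      then have "G M = 0" by (simp add: G_def sum_series_apply scale_series_def)
      then show False using that by simp
    qed
    \<comment> \<open>Triangularity makes a Schur function vanish at every other multiset with the
      index sum of its leading one, so only the term of \<open>M\<close> itself contributes.\<close>
    have G_X: "G M = F M" if "M \<in> X" for M
    proof -
      have "schur (shape N) M = 0" if N: "N \<in> X" "N \<noteq> M" for N
      proof (rule ccontr)
        assume "schur (shape N) M \<noteq> 0"
        then show False using tri(1)[OF N(1)] N \<open>M \<in> X\<close> by (force simp: X_def)
      qed
      then have "G M = (\<Sum>N \<in> X. if N = M then F M * schur (shape M) M else 0)"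
        unfolding G_def sum_series_apply scale_series_def by (intro sum.cong) auto
      also have "\<dots> = F M"
        using finX that schur_superstandard_content[OF shape(1)[OF that]] shape(2)[OF that] by simp
      finally show ?thesis .
    qed
    have sym: "symmetric_series (F - G)"
      unfolding G_def using shape(1)
      by (intro symmetric_series_diff symmetric_series_sum symmetric_series_scale symmetric_schur Suc.prems)
    have FG: "F M \<noteq> 0 \<or> G M \<noteq> 0" if "(F - G) M \<noteq> 0" for M using that by auto
    have size: "size M = n" if "(F - G) M \<noteq> 0" for M
      using FG[OF that] Suc.prems(2) G_nonzero tri(2) by blast
    have ge: "W \<le> sum_mset M + Suc d" if M: "(F - G) M \<noteq> 0" for M
    proof (cases "F M = 0")
      case True
      then obtain N where N: "N \<in> X" "schur (shape N) M \<noteq> 0" using FG[OF M] G_nonzero by blast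
      then show ?thesis using tri(1)[OF N] by (force simp: X_def)
    qed (use Suc.prems(3) in blast)
    \<comment> \<open>Each nonzero coefficient has a nonzero dominant one of no larger index sum,
      and the dominant ones on the lowest level have just been cleared.\<close>
    have "W \<le> sum_mset M + d" if M: "(F - G) M \<noteq> 0" for M
    proof -
      obtain N where N: "dominant N" "(F - G) N \<noteq> 0" "sum_mset N < sum_mset M \<or> N = M"
        using symmetric_series_dominant[OF sym M] .
      have "N \<notin> X" using N(2) G_X by auto
      then have "sum_mset N + Suc d \<noteq> W" using N(1) size[OF N(2)] unfolding X_def by blast
      then show ?thesis using ge[OF N(2)] N(3) by auto
    qed
    then have "F - G \<in> series.span (schur ` {mu. int_partition mu})"
      using Suc.IH[OF sym size] by blast
    then show ?case using G_span by (metis series.span_add diff_add_cancel)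
  qed
  then show ?thesis using assms by (meson le_add2)
qed

text \<open>Numbering the cells row by row produces a standard tableau.\<close>

lemma schur_linear_content_pos:
  assumes "card (cells la) = n"
  shows "0 < schur la (mset_set {1..n})"
proof -
  define f where "f = (\<lambda>(i, j). (\<Sum>i'<i. row_length la i') + Suc j)"
  have next_row: "(\<Sum>i'<i. row_length la i') + row_length la i \<le> (\<Sum>i'<i2. row_length la i')" if "i < i2" for i i2
  proof -
    have "(\<Sum>i'<Suc i. row_length la i') \<le> (\<Sum>i'<i2. row_length la i')"
      by (rule sum_mono2) (use that in auto)
    then show ?thesis by simp
  qed
  have less: "f (i, j) < f (i2, j2)" if "i < i2" "(i, j) \<in> cells la" for i j i2 j2
    using next_row[OF that(1)] that(2) by (simp add: f_def mem_cells_iff)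
  have inj: "inj_on f (cells la)"
  proof (rule inj_onI)
    fix c d assume cd: "c \<in> cells la" "d \<in> cells la" "f c = f d"
    obtain i j i2 j2 where [simp]: "c = (i, j)" "d = (i2, j2)" by fastforce
    have "i = i2" using less[of i i2 j j2] less[of i2 i j2 j] cd by (cases i i2 rule: linorder_cases) auto
    then show "c = d" using cd(3) by (simp add: f_def)
  qed
  have total: "n = (\<Sum>i<length la. row_length la i)"
  proof -
    have "cells la = (SIGMA i:{..<length la}. {..<row_length la i})"
      by (auto simp: cells_def row_length_def)
    then show ?thesis using assms by simp
  qed
  have "f c \<in> {1..n}" if c: "c \<in> cells la" for c
  proof -
    obtain i j where [simp]: "c = (i, j)" by fastforce
    have "i < length la" using c by (simp add: cells_def)
    then show ?thesis using next_row[of i "length la"] c total by (simp add: f_def mem_cells_iff)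
  qed
  then have img: "f ` cells la = {1..n}"
    using card_image[OF inj] assms by (intro card_subset_eq) auto
  let ?t = "restrict f (cells la)"
  have "image_mset ?t (mset_set (cells la)) = mset_set (?t ` cells la)"
    by (rule image_mset_mset_set) (use inj in \<open>simp add: inj_on_def\<close>)
  then have "image_mset ?t (mset_set (cells la)) = mset_set {1..n}" using img by simp
  moreover have "?t \<in> ssyt la"
  proof -
    have "1 \<le> f c" for c by (simp add: f_def case_prod_unfold)
    moreover have "f (i, j) \<le> f (i, Suc j)" for i j by (simp add: f_def)
    ultimately show ?thesis using less by (auto simp: ssyt_def)
  qed
  \<comment> \<open>An infinite set would have \<open>card\<close> equal to 0, so a witness alone
    does not give positivity.\<close>
  moreover have "finite {t \<in> ssyt la. image_mset t (mset_set (cells la)) = mset_set {1..n}}"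
  proof (rule finite_subset)
    show "{t \<in> ssyt la. image_mset t (mset_set (cells la)) = mset_set {1..n}} \<subseteq> cells la \<rightarrow>\<^sub>E {1..n}"
    proof
      fix t assume t: "t \<in> {t \<in> ssyt la. image_mset t (mset_set (cells la)) = mset_set {1..n}}"
      then have "set_mset (image_mset t (mset_set (cells la))) = set_mset (mset_set {1..n})" by simp
      then have "t ` cells la = {1..n}" by (simp add: finite_cells)
      then show "t \<in> cells la \<rightarrow>\<^sub>E {1..n}" using t by (auto simp: ssyt_def PiE_def)
    qed
  qed (simp add: finite_PiE finite_cells)
  ultimately have "card {t \<in> ssyt la. image_mset t (mset_set (cells la)) = mset_set {1..n}} > 0"
    by (auto simp: card_gt_0_iff)
  then show ?thesis by (simp add: schur_def)
qed

section \<open>Maximality of trees\<close>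

lemma chromatic_sf_homogeneous: "chromatic_sf G M \<noteq> 0 \<Longrightarrow> size M = card (pverts G)"
proof -
  assume "chromatic_sf G M \<noteq> 0"
  then have "{\<kappa> \<in> proper_colorings G. image_mset \<kappa> (mset_set (pverts G)) = M} \<noteq> {}"
    unfolding chromatic_sf_def by (metis card.empty of_nat_0)
  then show "size M = card (pverts G)" by auto
qed

lemma image_mset_eq_mset_set_iff:
  assumes "finite V" "card V = n"
  shows "image_mset \<kappa> (mset_set V) = mset_set {1..n} \<longleftrightarrow> bij_betw \<kappa> V {1..n}"
proof
  assume eq: "image_mset \<kappa> (mset_set V) = mset_set {1..n}"
  then have "set_mset (image_mset \<kappa> (mset_set V)) = set_mset (mset_set {1..n})" by simp
  then have "\<kappa> ` V = {1..n}" using assms by simp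
  moreover have "inj_on \<kappa> V"
    by (rule eq_card_imp_inj_on) (use assms \<open>\<kappa> ` V = {1..n}\<close> in auto)
  ultimately show "bij_betw \<kappa> V {1..n}" by (simp add: bij_betw_def)
next
  assume "bij_betw \<kappa> V {1..n}"
  then show "image_mset \<kappa> (mset_set V) = mset_set {1..n}"
    by (simp add: bij_betw_def image_mset_mset_set)
qed

text \<open>This replaces the value n!: comparing two graphs only takes the fact that the number of
  bijective colorings depends on the vertex set through its size.\<close>

lemma card_extensional_bij_betw:
  assumes h: "bij_betw h W V"
  shows "card {\<kappa> \<in> extensional V. bij_betw \<kappa> V D} = card {\<kappa> \<in> extensional W. bij_betw \<kappa> W D}"
proof (rule bij_betw_same_card[where f = "\<lambda>\<kappa>. \<lambda>x \<in> W. \<kappa> (h x)"], rule bij_betwI[where g = "\<lambda>\<kappa>. \<lambda>y \<in> V. \<kappa> (inv_into W h y)"])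
  have h': "bij_betw (inv_into W h) V W" using h by (rule bij_betw_inv_into)
  have mem: "h x \<in> V" if "x \<in> W" for x using h that by (rule bij_betwE[THEN bspec])
  have mem': "inv_into W h y \<in> W" if "y \<in> V" for y using h' that by (rule bij_betwE[THEN bspec])
  show "(\<lambda>\<kappa>. \<lambda>x \<in> W. \<kappa> (h x)) \<in> {\<kappa> \<in> extensional V. bij_betw \<kappa> V D} \<rightarrow> {\<kappa> \<in> extensional W. bij_betw \<kappa> W D}"
  proof
    fix \<kappa> assume "\<kappa> \<in> {\<kappa> \<in> extensional V. bij_betw \<kappa> V D}"
    then have "bij_betw (\<kappa> \<circ> h) W D" using h bij_betw_trans by blast
    then have "bij_betw (\<lambda>x \<in> W. \<kappa> (h x)) W D" by (simp cong: bij_betw_cong)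
    then show "(\<lambda>x \<in> W. \<kappa> (h x)) \<in> {\<kappa> \<in> extensional W. bij_betw \<kappa> W D}" by simp
  qed
  show "(\<lambda>\<kappa>. \<lambda>y \<in> V. \<kappa> (inv_into W h y)) \<in> {\<kappa> \<in> extensional W. bij_betw \<kappa> W D} \<rightarrow> {\<kappa> \<in> extensional V. bij_betw \<kappa> V D}"
  proof
    fix \<kappa> assume "\<kappa> \<in> {\<kappa> \<in> extensional W. bij_betw \<kappa> W D}"
    then have "bij_betw (\<kappa> \<circ> inv_into W h) V D" using h' bij_betw_trans by blast
    then have "bij_betw (\<lambda>y \<in> V. \<kappa> (inv_into W h y)) V D" by (simp cong: bij_betw_cong)
    then show "(\<lambda>y \<in> V. \<kappa> (inv_into W h y)) \<in> {\<kappa> \<in> extensional V. bij_betw \<kappa> V D}" by simp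
  qed
  show "(\<lambda>y \<in> V. (\<lambda>x \<in> W. \<kappa> (h x)) (inv_into W h y)) = \<kappa>" if "\<kappa> \<in> {\<kappa> \<in> extensional V. bij_betw \<kappa> V D}" for \<kappa>
    using that mem' bij_betw_inv_into_right[OF h] by (auto simp: fun_eq_iff extensional_def)
  show "(\<lambda>x \<in> W. (\<lambda>y \<in> V. \<kappa> (inv_into W h y)) (h x)) = \<kappa>" if "\<kappa> \<in> {\<kappa> \<in> extensional W. bij_betw \<kappa> W D}" for \<kappa>
    using that mem bij_betw_inv_into_left[OF h] by (auto simp: fun_eq_iff extensional_def)
qed

text \<open>With all colors distinct, properness is automatic because there are no loops.\<close>

lemma chromatic_sf_linear_content:
  assumes "pair_graph G" "card (pverts G) = n"
  shows "chromatic_sf G (mset_set {1..n}) =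
    of_nat (card {\<kappa> \<in> extensional (pverts G). bij_betw \<kappa> (pverts G) {1..n}})"
proof -
  interpret pair_graph G by fact
  have "{\<kappa> \<in> proper_colorings G. image_mset \<kappa> (mset_set (pverts G)) = mset_set {1..n}} =
      {\<kappa> \<in> extensional (pverts G). bij_betw \<kappa> (pverts G) {1..n}}"
  proof -
    have "\<kappa> \<in> proper_colorings G"
      if \<kappa>: "\<kappa> \<in> extensional (pverts G)" "bij_betw \<kappa> (pverts G) {1..n}" for \<kappa>
    proof -
      have neq: "\<kappa> u \<noteq> \<kappa> v" if "(u, v) \<in> parcs G" for u v
        using \<kappa>(2) that in_arcsD1 in_arcsD2 pair_graph_irrefl[OF assms(1)]
        by (metis bij_betw_def inj_onD irrefl_def)
      have "\<forall>(u, v) \<in> parcs G. \<kappa> u \<noteq> \<kappa> v" using neq by blast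
      moreover have "\<kappa> v \<in> {1..}" if "v \<in> pverts G" for v
        using bij_betwE[OF \<kappa>(2)] that by fastforce
      ultimately show ?thesis using \<kappa>(1) unfolding proper_colorings_def PiE_def Pi_def by blast
    qed
    moreover have "\<kappa> \<in> extensional (pverts G)" if "\<kappa> \<in> proper_colorings G" for \<kappa>
      using that by (auto simp: proper_colorings_def PiE_def)
    ultimately show ?thesis
      using image_mset_eq_mset_set_iff[OF pair_finite_verts assms(2)] by blast
  qed
  then show ?thesis by (simp add: chromatic_sf_def)
qed

lemma chromatic_sf_in_span_schur:
  assumes "pair_graph G"
  shows "chromatic_sf G \<in> series.span (schur ` {mu. int_partition mu})"
proof (rule symmetric_series_in_span_schur)
  interpret pair_graph G by fact
  show "symmetric_series (chromatic_sf G)"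
    unfolding chromatic_sf_eq_filling_series[OF assms]
    by (rule symmetric_filling_series) (rule pair_finite_verts)
qed (rule chromatic_sf_homogeneous)

lemma representation_schur_apply:
  assumes "series.independent (schur ` {mu. int_partition mu})"
    and "F \<in> series.span (schur ` {mu. int_partition mu})"
  defines "r \<equiv> series.representation (schur ` {mu. int_partition mu}) F"
  shows "F M = (\<Sum>b | r b \<noteq> 0. r b * b M)"
proof -
  have "F = (\<Sum>b | r b \<noteq> 0. scale_series (r b) b)"
    unfolding r_def using series.sum_nonzero_representation_eq[OF assms(1,2)] by simp
  then have "F M = (\<Sum>b | r b \<noteq> 0. scale_series (r b) b) M" by metis
  then show ?thesis by (simp add: sum_series_apply scale_series_def)
qed

text \<open>\<open>alt_sum n\<close> is linear, so its values on the Schur functions determine it on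
  their span.\<close>

lemma schur_coeff_column:
  assumes "series.independent (schur ` {mu. int_partition mu})"
    and "F \<in> series.span (schur ` {mu. int_partition mu})"
  shows "schur_coeff (replicate n 1) F = alt_sum n F"
proof -
  define r where "r = series.representation (schur ` {mu. int_partition mu}) F"
  let ?e = "schur (replicate n 1)"
  \<comment> \<open>The representation is indexed by series and not by shapes; a series other than
    \<open>?e\<close> comes from a shape other than the column.\<close>
  have e: "alt_sum n b = (if b = ?e then 1 else 0)" if "r b \<noteq> 0" for b
  proof -
    have "b \<in> schur ` {mu. int_partition mu}"
      using that series.representation_ne_zero unfolding r_def by blast
    then obtain mu where mu: "int_partition mu" "b = schur mu" by blast
    have "int_partition (replicate n 1)" by (simp add: int_partition_def sorted_wrt_iff_nth_less)
    then show ?thesis using alt_sum_schur[OF mu(1), of n] alt_sum_schur[of "replicate n 1" n] mu(2) by auto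
  qed
  have fin: "finite {b. r b \<noteq> 0}" unfolding r_def by (rule series.finite_representation)
  define w :: "nat multiset \<Rightarrow> rat" where "w M = (-1) ^ (n + card (set_mset M))" for M
  have alt: "alt_sum n G = (\<Sum>M \<in> packed_multisets n. w M * G M)" for G
    by (simp add: alt_sum_def w_def)
  have "alt_sum n F = (\<Sum>M \<in> packed_multisets n. \<Sum>b | r b \<noteq> 0. w M * (r b * b M))"
    by (simp only: alt representation_schur_apply[OF assms, folded r_def] sum_distrib_left)
  also have "\<dots> = (\<Sum>b | r b \<noteq> 0. \<Sum>M \<in> packed_multisets n. w M * (r b * b M))"
    by (rule sum.swap)
  also have "\<dots> = (\<Sum>b | r b \<noteq> 0. r b * alt_sum n b)"
    by (simp only: alt sum_distrib_left mult.left_commute)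
  also have "\<dots> = (\<Sum>b | r b \<noteq> 0. if b = ?e then r ?e else 0)"
    by (rule sum.cong) (auto simp: e)
  also have "\<dots> = r ?e" using fin by simp
  finally show ?thesis by (simp add: schur_coeff_def r_def)
qed

lemma schur_positive_eq_0:
  assumes "series.independent (schur ` {mu. int_partition mu})"
    and "F \<in> series.span (schur ` {mu. int_partition mu})"
    and "schur_positive F" "F (mset_set {1..n}) \<le> 0" "\<And>M. F M \<noteq> 0 \<Longrightarrow> size M = n"
  shows "F = 0"
proof
  fix M
  define r where "r = series.representation (schur ` {mu. int_partition mu}) F"
  note apply_F = representation_schur_apply[OF assms(1,2), folded r_def]
  have basis: "\<exists>mu. int_partition mu \<and> b = schur mu" if "r b \<noteq> 0" for b
    using that series.representation_ne_zero[of "schur ` {mu. int_partition mu}" F b] unfolding r_def by blast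
  have fin: "finite {b. r b \<noteq> 0}" unfolding r_def by (rule series.finite_representation)
  have nonneg: "0 \<le> r b * b (mset_set {1..n})" if b: "r b \<noteq> 0" for b
  proof -
    obtain mu where "int_partition mu" "b = schur mu" using basis[OF b] by blast
    then have "0 \<le> r b" using assms(3) unfolding schur_positive_def schur_coeff_def r_def by blast
    then show ?thesis unfolding \<open>b = schur mu\<close> by (simp add: schur_def)
  qed
  have "(\<Sum>b | r b \<noteq> 0. r b * b (mset_set {1..n})) = 0"
    using assms(4) nonneg unfolding apply_F by (intro order_antisym sum_nonneg) auto
  then have "\<forall>b \<in> {b. r b \<noteq> 0}. r b * b (mset_set {1..n}) = 0"
    by (subst (asm) sum_nonneg_eq_0_iff[OF fin]) (use nonneg in auto)
  then have zero: "b (mset_set {1..n}) = 0" if "r b \<noteq> 0" for b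
    using that by simp
  \<comment> \<open>A Schur function with nonzero coefficient in \<open>F\<close> vanishes at
    x_1...x_n, so its degree is not \<open>n\<close>, and it contributes nothing in degree
    \<open>n\<close>.\<close>
  have "b M = 0" if b: "r b \<noteq> 0" "size M = n" for b
  proof (rule ccontr)
    assume "b M \<noteq> 0"
    obtain mu where mu: "int_partition mu" "b = schur mu" using basis[OF b(1)] by blast
    then have "card (cells mu) = n" using \<open>b M \<noteq> 0\<close> schur_homogeneous b(2) by metis
    then show False using schur_linear_content_pos[of mu n] zero[OF b(1)] mu(2) by simp
  qed
  then have "F M = 0" if "size M = n"
    unfolding apply_F using that by (intro sum.neutral) auto
  then show "F M = 0 M" using assms(5) by (cases "size M = n") auto
qed

lemma schur_coeff_chromatic_sf:
  assumes "series.independent (schur ` {mu. int_partition mu})" "G \<in> connected_graphs n"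
  shows "schur_coeff (replicate n 1) (chromatic_sf G) =
    of_nat (card (acyclic_orientations (parcs G) (pverts G)))"
proof -
  have G: "pair_graph G" "card (pverts G) = n" using assms(2) by (auto simp: connected_graphs_def)
  then show ?thesis
    using schur_coeff_column[OF assms(1) chromatic_sf_in_span_schur[OF G(1)]] alt_sum_chromatic_sf[OF G(1)]
    by simp
qed

lemma schur_positive_diff_tree:
  assumes T: "tree_graph T" "T \<in> connected_graphs n" and H: "H \<in> connected_graphs n"
    and pos: "schur_positive (schur_diff H T)"
  shows "schur_positive (schur_diff T H)"
proof (cases "series.independent (schur ` {mu. int_partition mu})")
  case False
  \<comment> \<open>This case does not occur, but \<open>representation\<close> is \<open>0\<close> for a dependent set.\<close>
  then have "schur_coeff la F = 0" for la F
    unfolding schur_coeff_def series.representation_def by (simp only: simp_thms if_False)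
  then show ?thesis by (simp add: schur_positive_def)
next
  case indep: True
  define a where "a = schur_coeff (replicate n 1) (chromatic_sf T)"
  define b where "b = schur_coeff (replicate n 1) (chromatic_sf H)"
  have T': "pair_graph T" "connected (with_proj T)" "card (pverts T) = n"
    and H': "pair_graph H" "connected (with_proj H)" "card (pverts H) = n"
    using T(2) H by (auto simp: connected_graphs_def)
  have "a = 2 ^ (n - 1)"
    using card_acyclic_orientations_connected(2)[OF T'(1,2) T(1)] T'(3)
    unfolding a_def schur_coeff_chromatic_sf[OF indep T(2)] by simp
  moreover have "2 ^ (n - 1) \<le> b"
  proof -
    have "of_nat (2 ^ (n - 1)) \<le> (of_nat (card (acyclic_orientations (parcs H) (pverts H))) :: rat)"
      using card_acyclic_orientations_connected(1)[OF H'(1,2)] H'(3) by (metis of_nat_le_iff)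
    then show ?thesis unfolding b_def schur_coeff_chromatic_sf[OF indep H] by simp
  qed
  ultimately have ab: "0 < a" "a \<le> b" by simp_all
  have diff: "schur_diff H T = chromatic_sf H - scale_series (b / a) (chromatic_sf T)"
    "schur_diff T H = chromatic_sf T - scale_series (a / b) (chromatic_sf H)"
    by (simp_all add: schur_diff_def a_def b_def T'(3) H'(3))
  have "schur_diff H T = 0"
  proof (rule schur_positive_eq_0[OF indep _ pos])
    show "schur_diff H T \<in> series.span (schur ` {mu. int_partition mu})"
      unfolding diff
      by (intro series.span_diff series.span_scale chromatic_sf_in_span_schur T'(1) H'(1))
    have fin: "finite (pverts T)" "finite (pverts H)"
      using T'(1) H'(1) pair_fin_digraph.pair_finite_verts
      by (auto simp: pair_graph_def pair_digraph_def)
    then obtain h where "bij_betw h (pverts T) (pverts H)"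
      using T'(3) H'(3) finite_same_card_bij by metis
    then have "chromatic_sf H (mset_set {1..n}) = chromatic_sf T (mset_set {1..n})"
      unfolding chromatic_sf_linear_content[OF T'(1,3)] chromatic_sf_linear_content[OF H'(1,3)]
      by (simp only: card_extensional_bij_betw)
    then have "schur_diff H T (mset_set {1..n}) = (1 - b / a) * chromatic_sf T (mset_set {1..n})"
      by (simp add: diff scale_series_def algebra_simps)
    moreover have "1 - b / a \<le> 0" using ab by simp
    moreover have "0 \<le> chromatic_sf T (mset_set {1..n})" by (simp add: chromatic_sf_def)
    ultimately show "schur_diff H T (mset_set {1..n}) \<le> 0" by (simp add: mult_nonpos_nonneg)
    show "size M = n" if "schur_diff H T M \<noteq> 0" for M
    proof -
      have "chromatic_sf H M \<noteq> 0 \<or> chromatic_sf T M \<noteq> 0" using that by (auto simp: diff scale_series_def)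
      then show ?thesis using chromatic_sf_homogeneous T'(3) H'(3) by metis
    qed
  qed
  then have "chromatic_sf H = scale_series (b / a) (chromatic_sf T)" by (simp add: diff)
  then have "schur_diff T H = 0" using ab by (simp add: diff scale_series_def fun_eq_iff)
  then show ?thesis by (simp add: schur_positive_def schur_coeff_def series.representation_zero)
qed

theorem proposition4p10:
  fixes T :: "'v pair_pre_digraph" and n :: nat
  assumes "tree_graph T" and "card (pverts T) = n"
  shows "maximal_element (S_poset n) S_le (csf_equiv n `` {T})"
  unfolding maximal_element_def
proof (intro conjI ballI impI)
  have T: "T \<in> connected_graphs n" using assms by (simp add: tree_graph_def connected_graphs_def)
  then show "csf_equiv n `` {T} \<in> S_poset n" unfolding S_poset_def by (rule quotientI)
  fix y assume y_in: "y \<in> S_poset n" and le: "S_le (csf_equiv n `` {T}) y \<or> S_le y (csf_equiv n `` {T})"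
  obtain H where H: "H \<in> connected_graphs n" and y: "y = csf_equiv n `` {H}"
    using y_in unfolding S_poset_def by (rule quotientE)
  \<comment> \<open>One of the two comparabilities is the goal itself; the other says that
    \<open>T\<close> lies below \<open>H\<close>, where the difference is zero and the relation can
    be reversed.\<close>
  show "S_le y (csf_equiv n `` {T})"
    using le schur_positive_diff_tree[OF assms(1) T H]
    unfolding y S_le_classes[OF T H] S_le_classes[OF H T] by blast
qed

end
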